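(* Let $(X_n)_{n\ge 1}$ be the unbalanced step-reinforced random walk with parameters $p\in[0,1]$ and $\alpha\in(0,1]$ built from the i.i.d. real random variables $(\xi_n)_{n\ge1}$, let $T_n=\sum_{k=1}^n X_k$ and $a=(2p-1)\alpha$. Assume that $\mathbb E[\xi_1^2]<+\infty$, put $\mu_1=\mathbb E[\xi_1]$, $\mu_2=\mathbb E[\xi_1^2]$, and, for $a<1$, $\sigma^2=\mu_2-\frac{(1-\alpha)^2\mu_1^2}{(1-a)^2}$. (i) If $-1\le a<1/2$, then for any $\gamma>0$, $\frac{\sqrt n}{(\log n)^{\frac12+\gamma}}\left(\frac{T_n}{n}-\frac{(1-\alpha)\mu_1}{1-a}\right)\to0$ almost surely as $n\to+\infty$. (ii) If $a=1/2$, then for any $\gamma>0$, $\frac{\sqrt n}{\sqrt{\log n}\,(\log\log n)^{\frac12+\gamma}}\left(\frac{T_n}{n}-2(1-\alpha)\mu_1\right)\to0$ almost surely as $n\to+\infty$. (iii) If $1/2<a<1$, then there is a square-integrable random variable $L$ such that $n^{1-a}\left(\frac{T_n}{n}-\frac{(1-\alpha)\mu_1}{1-a}\right)\to L$ almost surely as $n\to+\infty$, and $$\mathbb E[L]=\frac{(\alpha-a)\mu_1}{(1-a)\Gamma(a+1)},$$ $$\mathbb E[L^2]=\frac{\mu_2}{\Gamma(2a+1)}-\frac{(1-\alpha)(1+\alpha-2a)\mu_1^2}{(1-a)^2\Gamma(2a+1)}+\frac{\sigma^2}{(2a-1)\Gamma(2a+1)}-\frac{2(1-\alpha)(\alpha-a)\mu_1^2}{(1-a)^2\Gamma(2a+1)}.$$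 Moreover, $L$ is degenerate (i.e. almost surely constant) if and only if $\mu_2=\mu_1^2$ and either $\mu_1=0$ or $p=1$.
   Context: $\Gamma$ is the Euler Gamma function. Unbalanced step-reinforced random walk with parameters $(p,\alpha)$: let $(\xi_n)_{n\ge1}$ be i.i.d. real random variables, let $(U_n)_{n\ge1}$ be independent with $U_n$ uniform on $\{1,\dots,n\}$, let $(\gamma_n)_{n\ge1}$ be i.i.d. with $\mathbb P(\gamma_n=1)=\alpha=1-\mathbb P(\gamma_n=0)$, and let $(\rho_n)_{n\ge1}$ be i.i.d. with $\mathbb P(\rho_n=1)=p=1-\mathbb P(\rho_n=-1)$; the four sequences are mutually independent. The steps are $X_1=\xi_1$ and, for $n\ge1$, $X_{n+1}=\gamma_n\rho_nX_{U_n}+(1-\gamma_n)\xi_{n+1}$; that is, $X_{n+1}$ equals $X_{U_n}$ with probability $p\alpha$, $-X_{U_n}$ with probability $(1-p)\alpha$, and $\xi_{n+1}$ with probability $1-\alpha$. (The exponent $\gamma>0$ in (i) and (ii) is a real number unrelated to the variables $\gamma_n$.) *)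

theory Defs
  imports "HOL-Probability.Probability"
begin

text \<open>
  All sequences are indexed from 1; the values at index 0 are unconstrained and never used.
  The defining equations of the steps \<open>X\<close> are required almost surely: \<open>U n\<close> lies in
  \<open>{1..n}\<close> and the signs and switches lie in their two-point ranges only up to a null set.
\<close>

locale step_reinforced_walk = prob_space M
  for M :: "'a measure" +
  fixes p \<alpha> :: real
    and \<xi> :: "nat \<Rightarrow> 'a \<Rightarrow> real"
    and U :: "nat \<Rightarrow> 'a \<Rightarrow> nat"
    and \<gamma> \<rho> :: "nat \<Rightarrow> 'a \<Rightarrow> real"
    and X :: "nat \<Rightarrow> 'a \<Rightarrow> real"
  assumes p_range: "0 \<le> p" "p \<le> 1"
    and \<alpha>_range: "0 < \<alpha>" "\<alpha> \<le> 1"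
    and \<xi>_indep: "indep_vars (\<lambda>_. borel) \<xi> {1..}"
    and \<xi>_ident: "\<And>n. n \<ge> 1 \<Longrightarrow> distr M borel (\<xi> n) = distr M borel (\<xi> 1)"
    and U_indep: "indep_vars (\<lambda>_. count_space UNIV) U {1..}"
    and U_uniform: "\<And>n k. k \<in> {1..n} \<Longrightarrow> prob {\<omega> \<in> space M. U n \<omega> = k} = 1 / real n"
    and \<gamma>_indep: "indep_vars (\<lambda>_. borel) \<gamma> {1..}"
    and \<gamma>_law: "\<And>n. n \<ge> 1 \<Longrightarrow> prob {\<omega> \<in> space M. \<gamma> n \<omega> = 1} = \<alpha>"
               "\<And>n. n \<ge> 1 \<Longrightarrow> prob {\<omega> \<in> space M. \<gamma> n \<omega> = 0} = 1 - \<alpha>"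
    and \<rho>_indep: "indep_vars (\<lambda>_. borel) \<rho> {1..}"
    and \<rho>_law: "\<And>n. n \<ge> 1 \<Longrightarrow> prob {\<omega> \<in> space M. \<rho> n \<omega> = 1} = p"
               "\<And>n. n \<ge> 1 \<Longrightarrow> prob {\<omega> \<in> space M. \<rho> n \<omega> = - 1} = 1 - p"
    \<comment> \<open>The four sequences, seen as random elements of the product space of real sequences,
       are mutually independent; \<open>U\<close> is coerced to the reals only to share a codomain.\<close>
    and sequences_indep:
      "indep_vars (\<lambda>_. Pi\<^sub>M {1..} (\<lambda>_. borel))
         (\<lambda>i \<omega>. \<lambda>n\<in>{1..}. ([\<xi>, \<lambda>n \<omega>. real (U n \<omega>), \<gamma>, \<rho>] ! i) n \<omega>) {..<4::nat}"
    and X_measurable: "\<And>n. n \<ge> 1 \<Longrightarrow> random_variable borel (X n)"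
    and X_first: "AE \<omega> in M. X 1 \<omega> = \<xi> 1 \<omega>"
    and X_step: "\<And>n. n \<ge> 1 \<Longrightarrow> AE \<omega> in M.
          X (n + 1) \<omega> = \<gamma> n \<omega> * \<rho> n \<omega> * X (U n \<omega>) \<omega> + (1 - \<gamma> n \<omega>) * \<xi> (n + 1) \<omega>"

end

theory Submission
  imports Defs "HOL-Real_Asymp.Real_Asymp"
begin

text \<open>
  With \<open>c = (1 - \<alpha>) \<mu>\<^sub>1 / (1 - a)\<close>, the deviation \<open>S n = T n - n c\<close> satisfies
  \<open>S (n + 1) = (1 + a / n) S n + \<epsilon> (n + 1)\<close>, where \<open>\<epsilon> (n + 1)\<close> has bounded second moments and
  is orthogonal to the past. For weights \<open>w\<close> with \<open>1 / w\<^sup>2\<close> summable, the series of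
  \<open>\<epsilon> n / w n\<close> therefore converges almost surely by Kolmogorov's maximal inequality. For the
  weights of (i) and (ii) the recursion for \<open>S n / w n\<close> is a contraction up to these summable
  perturbations, so that \<open>S n / w n\<close> tends to 0. For \<open>a > 1 / 2\<close> the weights
  \<open>w n = \<Gamma>(n + a) / \<Gamma>(n) \<sim> n powr a\<close> make \<open>S n / w n\<close> an L\<open>\<^sup>2\<close>-bounded martingale with limit \<open>L\<close>,
  and the recursions for the first two moments of \<open>S n\<close> can be solved in terms of \<open>\<Gamma>\<close>.
  The variances of the martingale increase, so a degenerate \<open>L\<close> forces the first two
  increments to be constant.
\<close>

section \<open>Square-integrable martingales\<close>

text \<open>The centre \<open>c\<close> is the fixed point of
  \<open>c = a * c + (1 - \<alpha>) * \<mu>\<^sub>1\<close>, which is why subtracting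
  \<open>n * c\<close> removes the drift. The bound on the perturbations rests on an invariance: a
  step is a signed copy of an earlier step or a fresh variable, so every squared step has mean
  \<open>\<mu>\<^sub>2\<close>. The exponents in (i) and (ii) are what makes the inverse squares of
  the weights summable: the squares are n (log n)^(1 + 2 \<delta>) and n log n (log log n)^(1 + 2
  \<delta>). Dividing by the product of the factors 1 + a / k, as in (iii), would fail at a = -1,
  where the factor at k = 1 vanishes; the contraction argument only asks for nonnegative factors.
  Factors at most 1 do not yet force the limit 0: their product must vanish. The room for this is
  the gap 1/2 - a in (i) and the extra square root of the logarithm in (ii). Two features of the
  model shape the rest: its equations hold only almost surely, and a step refers to an earlier one
  through a random index. Hence the passage to a version of the walk defined at every outcome and
  expanded over the values of \<open>U n\<close> into products of independent factors.\<close>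

lemma integrable_mult_of_squares:
  fixes f g :: "'a \<Rightarrow> real"
  assumes [measurable]: "f \<in> borel_measurable M" "g \<in> borel_measurable M"
    and f: "integrable M (\<lambda>x. (f x)\<^sup>2)" and g: "integrable M (\<lambda>x. (g x)\<^sup>2)"
  shows "integrable M (\<lambda>x. f x * g x)"
proof (rule Bochner_Integration.integrable_bound)
  show "integrable M (\<lambda>x. (f x)\<^sup>2 + (g x)\<^sup>2)"
    using f g by simp
  have "\<bar>f x * g x\<bar> \<le> (f x)\<^sup>2 + (g x)\<^sup>2" for x
  proof -
    have "2 * (\<bar>f x\<bar> * \<bar>g x\<bar>) \<le> (f x)\<^sup>2 + (g x)\<^sup>2"
      using sum_squares_bound[of "\<bar>f x\<bar>" "\<bar>g x\<bar>"] by (simp add: mult.assoc)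
    moreover have "0 \<le> \<bar>f x\<bar> * \<bar>g x\<bar>" by simp
    ultimately show ?thesis unfolding abs_mult by linarith
  qed
  then show "AE x in M. norm (f x * g x) \<le> norm ((f x)\<^sup>2 + (g x)\<^sup>2)"
    by auto
qed measurable

lemma integrable_square_add:
  fixes f g :: "'a \<Rightarrow> real"
  assumes "f \<in> borel_measurable M" "g \<in> borel_measurable M"
    and "integrable M (\<lambda>x. (f x)\<^sup>2)" and "integrable M (\<lambda>x. (g x)\<^sup>2)"
  shows "integrable M (\<lambda>x. (f x + g x)\<^sup>2)"
  using integrable_mult_of_squares[OF assms] assms
  by (simp add: power2_sum mult.assoc)

lemma integrable_square_sum:
  fixes f :: "'i \<Rightarrow> 'a \<Rightarrow> real"
  assumes "\<And>i. i \<in> A \<Longrightarrow> f i \<in> borel_measurable M"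
    and "\<And>i. i \<in> A \<Longrightarrow> integrable M (\<lambda>x. (f i x)\<^sup>2)"
  shows "integrable M (\<lambda>x. (\<Sum>i\<in>A. f i x)\<^sup>2)"
  using assms
proof (induction A rule: infinite_finite_induct)
  case (insert i A)
  then show ?case
    by (auto intro!: integrable_square_add)
qed auto

text \<open>A square-integrable martingale is given through its increments; the martingale property
  is stated as orthogonality to the square-integrable functions of the past.\<close>

locale martingale_differences = prob_space M for M :: "'a measure" +
  fixes F :: "nat \<Rightarrow> 'a measure" and D :: "nat \<Rightarrow> 'a \<Rightarrow> real"
  assumes subalgebra: "\<And>n. subalgebra M (F n)"
    and filtration: "\<And>m n. m \<le> n \<Longrightarrow> subalgebra (F n) (F m)"
    and adapted: "\<And>n. D n \<in> borel_measurable (F n)"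
    and square_integrable: "\<And>n. integrable M (\<lambda>\<omega>. (D n \<omega>)\<^sup>2)"
    and orthogonal: "\<And>n Z. Z \<in> borel_measurable (F n) \<Longrightarrow> integrable M (\<lambda>\<omega>. (Z \<omega>)\<^sup>2) \<Longrightarrow>
          (\<integral>\<omega>. Z \<omega> * D (Suc n) \<omega> \<partial>M) = 0"
begin

text \<open>The term \<open>D 0\<close> is an arbitrary initial value: \<open>orthogonal\<close>
  constrains only \<open>D (Suc n)\<close>, so the mean of \<open>S n\<close> need not be 0.\<close>

definition S :: "nat \<Rightarrow> 'a \<Rightarrow> real" where
  "S n \<omega> = (\<Sum>k\<le>n. D k \<omega>)"

lemma S_Suc: "S (Suc n) \<omega> = S n \<omega> + D (Suc n) \<omega>"
  by (simp add: S_def)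

lemma adapted_le: "k \<le> n \<Longrightarrow> D k \<in> borel_measurable (F n)"
  using measurable_from_subalg[OF filtration adapted] .

lemma S_adapted_le: "k \<le> n \<Longrightarrow> S k \<in> borel_measurable (F n)"
  unfolding S_def[abs_def] by (intro borel_measurable_sum adapted_le) auto

lemma adapted_measurable: "f \<in> borel_measurable (F n) \<Longrightarrow> f \<in> borel_measurable M"
  using measurable_from_subalg[OF subalgebra] .

lemma D_measurable [measurable]: "D n \<in> borel_measurable M"
  using adapted by (rule adapted_measurable)

lemma S_measurable [measurable]: "S n \<in> borel_measurable M"
  by (rule adapted_measurable[OF S_adapted_le[OF order_refl]])

lemma S_square_integrable: "integrable M (\<lambda>\<omega>. (S n \<omega>)\<^sup>2)"
  unfolding S_def by (intro integrable_square_sum square_integrable) auto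

lemma transform_square_integrable:
  assumes "c \<in> borel_measurable (F n)" "\<And>\<omega>. \<bar>c \<omega>\<bar> \<le> 1"
  shows "integrable M (\<lambda>\<omega>. (c \<omega> * D k \<omega>)\<^sup>2)"
proof (rule Bochner_Integration.integrable_bound[OF square_integrable[of k]])
  have [measurable]: "c \<in> borel_measurable M"
    using assms(1) by (rule adapted_measurable)
  show "(\<lambda>\<omega>. (c \<omega> * D k \<omega>)\<^sup>2) \<in> borel_measurable M" by measurable
  show "AE \<omega> in M. norm ((c \<omega> * D k \<omega>)\<^sup>2) \<le> norm ((D k \<omega>)\<^sup>2)"
    using assms(2) by (auto simp: power_mult_distrib abs_square_le_1 intro!: mult_left_le_one_le)
qed

text \<open>In the cross term the factor \<open>c n\<close>, known at time \<open>n\<close>, can be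
  moved over to the earlier sum, and the product is a square-integrable function of the past,
  orthogonal to \<open>D (Suc n)\<close>. Deterministic coefficients give the increments of
  \<open>S\<close>, stopping indicators the maximal inequality.\<close>

lemma transform_second_moment:
  assumes c: "\<And>n. c n \<in> borel_measurable (F n)" "\<And>n \<omega>. \<bar>c n \<omega>\<bar> \<le> 1"
  shows "(\<integral>\<omega>. (\<Sum>j<n. c j \<omega> * D (Suc j) \<omega>)\<^sup>2 \<partial>M) = (\<Sum>j<n. \<integral>\<omega>. (c j \<omega> * D (Suc j) \<omega>)\<^sup>2 \<partial>M)"
proof (induction n)
  case (Suc n)
  define V where "V \<omega> = (\<Sum>j<n. c j \<omega> * D (Suc j) \<omega>)" for \<omega>
  have cF: "c j \<in> borel_measurable (F n)" if "j \<le> n" for j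
    using measurable_from_subalg[OF filtration[OF that] c(1)] .
  have [measurable]: "c j \<in> borel_measurable M" for j
    using c(1) by (rule adapted_measurable)
  have VF: "V \<in> borel_measurable (F n)"
    unfolding V_def[abs_def] by (intro borel_measurable_sum borel_measurable_times cF adapted_le) auto
  then have [measurable]: "V \<in> borel_measurable M"
    by (rule adapted_measurable)
  have D2: "integrable M (\<lambda>\<omega>. (c n \<omega> * D (Suc n) \<omega>)\<^sup>2)"
    using c by (rule transform_square_integrable)
  have V2: "integrable M (\<lambda>\<omega>. (V \<omega>)\<^sup>2)"
    unfolding V_def by (intro integrable_square_sum transform_square_integrable[OF c]) measurable
  have VD: "integrable M (\<lambda>\<omega>. V \<omega> * (c n \<omega> * D (Suc n) \<omega>))"
    by (intro integrable_mult_of_squares V2 D2) measurable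
  have "integrable M (\<lambda>\<omega>. (V \<omega> * c n \<omega>)\<^sup>2)"
  proof (rule Bochner_Integration.integrable_bound[OF V2])
    show "AE \<omega> in M. norm ((V \<omega> * c n \<omega>)\<^sup>2) \<le> norm ((V \<omega>)\<^sup>2)"
      using c(2) by (auto simp: power_mult_distrib abs_square_le_1 intro!: mult_right_le_one_le)
  qed measurable
  then have "(\<integral>\<omega>. (V \<omega> * c n \<omega>) * D (Suc n) \<omega> \<partial>M) = 0"
    by (intro orthogonal borel_measurable_times VF c(1))
  then have *: "(\<integral>\<omega>. V \<omega> * (c n \<omega> * D (Suc n) \<omega>) \<partial>M) = 0"
    by (simp add: mult.assoc)
  have "(\<integral>\<omega>. (V \<omega> + c n \<omega> * D (Suc n) \<omega>)\<^sup>2 \<partial>M) =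
      (\<integral>\<omega>. (V \<omega>)\<^sup>2 \<partial>M) + (\<integral>\<omega>. (c n \<omega> * D (Suc n) \<omega>)\<^sup>2 \<partial>M)"
    using V2 D2 VD * by (simp add: power2_sum mult.assoc)
  then show ?case
    using Suc by (simp add: V_def)
qed simp

lemma increment_second_moment:
  assumes "m \<le> n"
  shows "(\<integral>\<omega>. (S n \<omega> - S m \<omega>)\<^sup>2 \<partial>M) = (\<Sum>k\<in>{m..<n}. \<integral>\<omega>. (D (Suc k) \<omega>)\<^sup>2 \<partial>M)"
proof -
  have eq: "S n \<omega> - S m \<omega> = (\<Sum>j<n. (if m \<le> j then 1 else 0) * D (Suc j) \<omega>)" for \<omega>
    using assms
  proof (induction n rule: dec_induct)
    case (step n)
    then show ?case by (simp add: S_Suc)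
  qed simp
  have "(\<integral>\<omega>. (S n \<omega> - S m \<omega>)\<^sup>2 \<partial>M) =
      (\<Sum>j<n. \<integral>\<omega>. ((if m \<le> j then 1 else 0) * D (Suc j) \<omega>)\<^sup>2 \<partial>M)"
    unfolding eq by (rule transform_second_moment) auto
  also have "\<dots> = (\<Sum>j<n. if m \<le> j then \<integral>\<omega>. (D (Suc j) \<omega>)\<^sup>2 \<partial>M else 0)"
    by (intro sum.cong) auto
  also have "\<dots> = (\<Sum>k\<in>{m..<n}. \<integral>\<omega>. (D (Suc k) \<omega>)\<^sup>2 \<partial>M)"
    by (rule sum.mono_neutral_cong_right) auto
  finally show ?thesis .
qed

text \<open>Kolmogorov's maximal inequality by optional stopping: the martingale stopped on leaving the
  \<open>e\<close>-ball has a second moment at most that of the original one, and stays outside the ball.\<close>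

lemma maximal_inequality:
  assumes "0 < e" "m \<le> n"
  shows "prob {\<omega>\<in>space M. \<exists>k\<in>{m..n}. e \<le> \<bar>S k \<omega> - S m \<omega>\<bar>}
      \<le> (\<Sum>k\<in>{m..<n}. \<integral>\<omega>. (D (Suc k) \<omega>)\<^sup>2 \<partial>M) / e\<^sup>2"
proof -
  define c :: "nat \<Rightarrow> 'a \<Rightarrow> real" where
    "c j \<omega> = (if m \<le> j \<and> (\<forall>i\<in>{m..j}. \<bar>S i \<omega> - S m \<omega>\<bar> < e) then 1 else 0)" for j \<omega>
  define V where "V n \<omega> = (\<Sum>j<n. c j \<omega> * D (Suc j) \<omega>)" for n \<omega>
  have cF: "c j \<in> borel_measurable (F j)" for j
  proof (cases "m \<le> j")
    case True
    have [measurable]: "S m \<in> borel_measurable (F j)" "\<And>i. i \<in> {m..j} \<Longrightarrow> S i \<in> borel_measurable (F j)"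
      using True by (auto intro: S_adapted_le)
    show ?thesis unfolding c_def[abs_def] by measurable
  qed (simp add: c_def[abs_def])
  have c1: "\<bar>c j \<omega>\<bar> \<le> 1" for j \<omega> by (simp add: c_def)
  have V0: "V m \<omega> = 0" for \<omega>
    by (auto simp: V_def c_def intro!: sum.neutral)
  \<comment> \<open>\<open>V\<close> follows \<open>S - S m\<close> up to the first exit and keeps
    the exit value afterwards. The coefficient \<open>c j\<close> is decided by the path up to time
    \<open>j\<close>, before the increment \<open>D (Suc j)\<close> that it multiplies.\<close>
  have hit: "if \<forall>i\<in>{m..n}. \<bar>S i \<omega> - S m \<omega>\<bar> < e then V n \<omega> = S n \<omega> - S m \<omega> else e \<le> \<bar>V n \<omega>\<bar>" for \<omega>
    using \<open>m \<le> n\<close>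
  proof (induction n rule: dec_induct)
    case base
    then show ?case using V0 \<open>0 < e\<close> by simp
  next
    case (step n)
    have V: "V (Suc n) \<omega> = V n \<omega> + c n \<omega> * D (Suc n) \<omega>"
      by (simp add: V_def)
    have ivl: "{m..Suc n} = insert (Suc n) {m..n}" using step by auto
    show ?case
    proof (cases "\<forall>i\<in>{m..n}. \<bar>S i \<omega> - S m \<omega>\<bar> < e")
      case True
      then have "c n \<omega> = 1" using step by (simp add: c_def)
      then have "V (Suc n) \<omega> = S (Suc n) \<omega> - S m \<omega>"
        using V step True by (simp add: S_Suc)
      then show ?thesis using True unfolding ivl by auto
    next
      case False
      then have "c n \<omega> = 0" by (simp only: c_def) simp
      then show ?thesis using False V step by (auto simp: ivl)
    qed
  qed
  have [measurable]: "c j \<in> borel_measurable M" for j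
    using cF by (rule adapted_measurable)
  have [measurable]: "V n \<in> borel_measurable M"
    unfolding V_def by measurable
  have V2: "integrable M (\<lambda>\<omega>. (V n \<omega>)\<^sup>2)"
    unfolding V_def by (intro integrable_square_sum transform_square_integrable[OF cF c1]) measurable
  have "prob {\<omega>\<in>space M. \<exists>k\<in>{m..n}. e \<le> \<bar>S k \<omega> - S m \<omega>\<bar>} \<le> prob {\<omega>\<in>space M. e\<^sup>2 \<le> (V n \<omega>)\<^sup>2}"
  proof (rule finite_measure_mono)
    show "{\<omega>\<in>space M. \<exists>k\<in>{m..n}. e \<le> \<bar>S k \<omega> - S m \<omega>\<bar>} \<subseteq> {\<omega>\<in>space M. e\<^sup>2 \<le> (V n \<omega>)\<^sup>2}"
    proof safe
      fix \<omega> k assume "k \<in> {m..n}" "e \<le> \<bar>S k \<omega> - S m \<omega>\<bar>"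
      then have "e \<le> \<bar>V n \<omega>\<bar>" using hit[of \<omega>] by (metis linorder_not_less)
      then show "e\<^sup>2 \<le> (V n \<omega>)\<^sup>2" using power_mono[of e "\<bar>V n \<omega>\<bar>" 2] \<open>0 < e\<close> by simp
    qed
  qed measurable
  also have "\<dots> \<le> (\<integral>\<omega>. (V n \<omega>)\<^sup>2 \<partial>M) / e\<^sup>2"
    using integral_Markov_inequality_measure[OF V2, of "{}" "e\<^sup>2"] \<open>0 < e\<close> by simp
  also have "(\<integral>\<omega>. (V n \<omega>)\<^sup>2 \<partial>M) = (\<Sum>j<n. \<integral>\<omega>. (c j \<omega> * D (Suc j) \<omega>)\<^sup>2 \<partial>M)"
    unfolding V_def by (rule transform_second_moment[OF cF c1])
  also have "\<dots> = (\<Sum>j\<in>{m..<n}. \<integral>\<omega>. (c j \<omega> * D (Suc j) \<omega>)\<^sup>2 \<partial>M)"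
    by (rule sum.mono_neutral_right) (auto simp: c_def)
  also have "\<dots> \<le> (\<Sum>k\<in>{m..<n}. \<integral>\<omega>. (D (Suc k) \<omega>)\<^sup>2 \<partial>M)"
    using c1 by (intro sum_mono integral_mono transform_square_integrable[OF cF] square_integrable)
      (auto simp: power_mult_distrib abs_square_le_1 intro!: mult_left_le_one_le)
  finally show ?thesis using \<open>0 < e\<close> by (simp add: divide_right_mono)
qed

context
  assumes summable: "summable (\<lambda>n. \<integral>\<omega>. (D n \<omega>)\<^sup>2 \<partial>M)"
begin

text \<open>The increments \<open>D 0, ..., D m\<close> cancel in \<open>S n - S m\<close>; the sum
  therefore starts with \<open>D (Suc m)\<close>.\<close>

definition tail :: "nat \<Rightarrow> real" where
  "tail m = (\<Sum>k. \<integral>\<omega>. (D (Suc (k + m)) \<omega>)\<^sup>2 \<partial>M)"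

lemma tail_tendsto: "tail \<longlonglongrightarrow> 0"
proof -
  have "summable (\<lambda>n. \<integral>\<omega>. (D (Suc n) \<omega>)\<^sup>2 \<partial>M)"
    using summable by (subst summable_Suc_iff)
  from suminf_exist_split2[OF this] show ?thesis
    by (simp add: tail_def[abs_def])
qed

lemma partial_tail_le: "(\<Sum>k\<in>{m..<n}. \<integral>\<omega>. (D (Suc k) \<omega>)\<^sup>2 \<partial>M) \<le> tail m"
proof (cases "m \<le> n")
  case True
  have s: "summable (\<lambda>k. \<integral>\<omega>. (D (Suc (k + m)) \<omega>)\<^sup>2 \<partial>M)"
    using summable_ignore_initial_segment[OF summable, of "Suc m"] by simp
  have "(\<Sum>k\<in>{m..<n}. \<integral>\<omega>. (D (Suc k) \<omega>)\<^sup>2 \<partial>M) = (\<Sum>k<n - m. \<integral>\<omega>. (D (Suc (k + m)) \<omega>)\<^sup>2 \<partial>M)"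
    using True by (intro sum.reindex_bij_witness[of _ "\<lambda>k. k + m" "\<lambda>k. k - m"]) auto
  also have "\<dots> \<le> tail m"
    unfolding tail_def by (intro sum_le_suminf s) auto
  finally show ?thesis .
next
  case False
  then show ?thesis unfolding tail_def
    using summable_ignore_initial_segment[OF summable, of "Suc m"]
    by (auto intro!: suminf_nonneg)
qed

text \<open>With \<open>tail m\<close> in place of the partial sum, the maximal inequality is
  uniform in the horizon \<open>n\<close>, and continuity from below lets \<open>n\<close> tend to
  infinity.\<close>

lemma prob_oscillation_le:
  assumes "0 < e"
  shows "prob {\<omega>\<in>space M. \<exists>k\<ge>m. e \<le> \<bar>S k \<omega> - S m \<omega>\<bar>} \<le> tail m / e\<^sup>2"
proof -
  let ?A = "\<lambda>n. {\<omega>\<in>space M. \<exists>k\<in>{m..n}. e \<le> \<bar>S k \<omega> - S m \<omega>\<bar>}"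
  have "(\<lambda>n. prob (?A n)) \<longlonglongrightarrow> prob (\<Union>n. ?A n)"
    by (rule finite_Lim_measure_incseq) (auto simp: incseq_def)
  moreover have "prob (?A n) \<le> tail m / e\<^sup>2" if "m \<le> n" for n
    using maximal_inequality[OF assms that] partial_tail_le[of m n]
    by (meson divide_right_mono order_trans zero_le_power2)
  moreover have "(\<Union>n. ?A n) = {\<omega>\<in>space M. \<exists>k\<ge>m. e \<le> \<bar>S k \<omega> - S m \<omega>\<bar>}"
    by (force intro: atLeastAtMost_iff[THEN iffD2])
  ultimately show ?thesis
    by (auto intro: LIMSEQ_le_const2)
qed

text \<open>A path that oscillates by \<open>e\<close> after every time \<open>m\<close> lies in
  events of probability at most \<open>tail m / e\<^sup>2\<close>, which tends to 0. Letting
  \<open>e\<close> run through the numbers \<open>inverse (real (Suc i))\<close> keeps the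
  exceptional set null, and the remaining paths are Cauchy.\<close>

lemma AE_convergent: "AE \<omega> in M. convergent (\<lambda>n. S n \<omega>)"
proof -
  have osc: "AE \<omega> in M. \<exists>m. \<forall>k\<ge>m. \<bar>S k \<omega> - S m \<omega>\<bar> < e" if "0 < e" for e
  proof -
    let ?N = "{\<omega>\<in>space M. \<forall>m. \<exists>k\<ge>m. e \<le> \<bar>S k \<omega> - S m \<omega>\<bar>}"
    have "prob ?N \<le> tail m / e\<^sup>2" for m
    proof -
      have "prob ?N \<le> prob {\<omega>\<in>space M. \<exists>k\<ge>m. e \<le> \<bar>S k \<omega> - S m \<omega>\<bar>}"
        by (intro finite_measure_mono) auto
      then show ?thesis using prob_oscillation_le[OF that, of m] by linarith
    qed
    moreover have "(\<lambda>m. tail m / e\<^sup>2) \<longlonglongrightarrow> 0"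
      using tail_tendsto by (rule tendsto_divide_zero)
    ultimately have "prob ?N \<le> 0"
      by (intro LIMSEQ_le_const) auto
    then have "prob ?N = 0"
      using measure_nonneg[of M ?N] by linarith
    moreover have "?N \<in> events" by measurable
    ultimately have "AE \<omega> in M. \<omega> \<notin> ?N"
      by (subst (asm) prob_eq_0) auto
    then show ?thesis
      using AE_space by eventually_elim (simp add: not_le[symmetric])
  qed
  have "AE \<omega> in M. \<forall>i. \<exists>m. \<forall>k\<ge>m. \<bar>S k \<omega> - S m \<omega>\<bar> < inverse (real (Suc i))"
    by (subst AE_all_countable) (auto intro!: osc)
  then show ?thesis
  proof (eventually_elim)
    case (elim \<omega>)
    show ?case
    proof (rule Cauchy_convergent, rule CauchyI')
      fix e :: real assume "0 < e"
      then obtain i where i: "inverse (real (Suc i)) < e / 2"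
        by (metis reals_Archimedean half_gt_zero)
      then obtain m where m: "\<And>k. k \<ge> m \<Longrightarrow> \<bar>S k \<omega> - S m \<omega>\<bar> < e / 2"
        using elim by (meson less_trans)
      show "\<exists>m. \<forall>k\<ge>m. \<forall>n>k. dist (S k \<omega>) (S n \<omega>) < e"
      proof (intro exI[of _ m] allI impI)
        fix k n assume "m \<le> k" "k < n"
        then show "dist (S k \<omega>) (S n \<omega>) < e"
          using m[of k] m[of n] unfolding dist_real_def by linarith
      qed
    qed
  qed
qed

end

end

text \<open>Young's inequality with a free parameter: a small \<open>t\<close> makes the term in
  \<open>y\<close> negligible, while the large constant falls on \<open>(x - y)\<^sup>2\<close>,
  which is to tend to 0.\<close>

lemma abs_diff_squares_le:
  fixes x y t :: real
  assumes "0 < t"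
  shows "\<bar>x\<^sup>2 - y\<^sup>2\<bar> \<le> (1 + 1 / t) * (x - y)\<^sup>2 + t * y\<^sup>2"
proof -
  have "2 * (\<bar>x - y\<bar> * \<bar>y\<bar>) \<le> (x - y)\<^sup>2 / t + t * y\<^sup>2"
    using sum_squares_bound[of "\<bar>x - y\<bar> / sqrt t" "sqrt t * \<bar>y\<bar>"] assms
    by (simp add: power_divide power_mult_distrib)
  moreover have "x\<^sup>2 - y\<^sup>2 = (x - y)\<^sup>2 + 2 * ((x - y) * y)"
    by (simp add: power2_eq_square algebra_simps)
  then have "\<bar>x\<^sup>2 - y\<^sup>2\<bar> \<le> (x - y)\<^sup>2 + 2 * (\<bar>x - y\<bar> * \<bar>y\<bar>)"
    using abs_triangle_ineq[of "(x - y)\<^sup>2" "2 * ((x - y) * y)"] by (simp add: abs_mult)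
  ultimately show ?thesis using assms by (simp add: algebra_simps)
qed

section \<open>Moments of almost sure limits of L^2-Cauchy sequences\<close>

context prob_space
begin

text \<open>By Fatou's lemma in \<open>n\<close>, the bound \<open>t m\<close> passes to the
  distance between \<open>g\<close> and \<open>f m\<close>, so the almost sure limit is also the
  limit in L^2. Convergence in L^2 carries the first two moments along.\<close>

lemma L2_limit:
  fixes f :: "nat \<Rightarrow> 'a \<Rightarrow> real"
  assumes f [measurable]: "\<And>n. f n \<in> borel_measurable M" and g [measurable]: "g \<in> borel_measurable M"
    and f2: "\<And>n. integrable M (\<lambda>\<omega>. (f n \<omega>)\<^sup>2)"
    and cauchy: "\<And>m n. m \<le> n \<Longrightarrow> (\<integral>\<omega>. (f n \<omega> - f m \<omega>)\<^sup>2 \<partial>M) \<le> t m" and t: "t \<longlonglongrightarrow> 0"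
    and lim: "AE \<omega> in M. (\<lambda>n. f n \<omega>) \<longlonglongrightarrow> g \<omega>"
  shows "integrable M (\<lambda>\<omega>. (g \<omega>)\<^sup>2)"
    and "(\<lambda>n. \<integral>\<omega>. f n \<omega> \<partial>M) \<longlonglongrightarrow> (\<integral>\<omega>. g \<omega> \<partial>M)"
    and "(\<lambda>n. \<integral>\<omega>. (f n \<omega>)\<^sup>2 \<partial>M) \<longlonglongrightarrow> (\<integral>\<omega>. (g \<omega>)\<^sup>2 \<partial>M)"
proof -
  have d2: "integrable M (\<lambda>\<omega>. (f n \<omega> - f m \<omega>)\<^sup>2)" for m n
    using integrable_square_add[of "f n" M "\<lambda>\<omega>. - f m \<omega>"] f2 by simp
  have nn: "(\<integral>\<^sup>+\<omega>. ennreal ((g \<omega> - f m \<omega>)\<^sup>2) \<partial>M) \<le> ennreal (t m)" for m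
  proof -
    have "(\<integral>\<^sup>+\<omega>. ennreal ((g \<omega> - f m \<omega>)\<^sup>2) \<partial>M)
        = (\<integral>\<^sup>+\<omega>. liminf (\<lambda>n. ennreal ((f n \<omega> - f m \<omega>)\<^sup>2)) \<partial>M)"
    proof (rule nn_integral_cong_AE)
      show "AE \<omega> in M. ennreal ((g \<omega> - f m \<omega>)\<^sup>2) = liminf (\<lambda>n. ennreal ((f n \<omega> - f m \<omega>)\<^sup>2))"
        using lim
      proof eventually_elim
        case (elim \<omega>)
        then have "(\<lambda>n. ennreal ((f n \<omega> - f m \<omega>)\<^sup>2)) \<longlonglongrightarrow> ennreal ((g \<omega> - f m \<omega>)\<^sup>2)"
          by (intro tendsto_intros tendsto_ennrealI)
        then show ?case by (intro lim_imp_Liminf[symmetric]) simp_all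
      qed
    qed
    also have "\<dots> \<le> liminf (\<lambda>n. \<integral>\<^sup>+\<omega>. ennreal ((f n \<omega> - f m \<omega>)\<^sup>2) \<partial>M)"
      by (rule nn_integral_liminf) measurable
    also have "\<dots> = liminf (\<lambda>n. ennreal (\<integral>\<omega>. (f n \<omega> - f m \<omega>)\<^sup>2 \<partial>M))"
      by (subst nn_integral_eq_integral) (use d2 in auto)
    also have "\<dots> \<le> limsup (\<lambda>n. ennreal (\<integral>\<omega>. (f n \<omega> - f m \<omega>)\<^sup>2 \<partial>M))"
      by (rule Liminf_le_Limsup) simp
    also have "\<dots> \<le> ennreal (t m)"
      by (intro Limsup_bounded) (auto intro!: eventually_sequentiallyI[of m] ennreal_leI cauchy)
    finally show ?thesis .
  qed
  have gd2: "integrable M (\<lambda>\<omega>. (g \<omega> - f m \<omega>)\<^sup>2)" for m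
    using nn[of m] by (intro integrableI_bounded) (auto simp: less_top[symmetric] top_unique)
  have gf: "(\<integral>\<omega>. (g \<omega> - f m \<omega>)\<^sup>2 \<partial>M) \<le> t m" for m
  proof -
    \<comment> \<open>\<open>ennreal\<close> sends negative numbers to 0, so the sign of
      \<open>t m\<close> must be known before returning to real integrals; the Cauchy bound at
      \<open>n = m\<close> supplies it.\<close>
    have "0 \<le> t m" using cauchy[of m m] by simp
    then show ?thesis
      using nn[of m] by (subst (asm) nn_integral_eq_integral[OF gd2]) auto
  qed
  show g2: "integrable M (\<lambda>\<omega>. (g \<omega>)\<^sup>2)"
    using integrable_square_add[OF _ _ gd2[of 0] f2[of 0]] by simp
  have gi: "integrable M g" and fi: "integrable M (f n)" for n
    using square_integrable_imp_integrable g2 f2 f g by blast+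
  have gd_lim: "(\<lambda>m. \<integral>\<omega>. (g \<omega> - f m \<omega>)\<^sup>2 \<partial>M) \<longlonglongrightarrow> 0"
    by (rule tendsto_sandwich[OF _ _ tendsto_const t]) (auto intro!: always_eventually gf)
  show "(\<lambda>n. \<integral>\<omega>. f n \<omega> \<partial>M) \<longlonglongrightarrow> (\<integral>\<omega>. g \<omega> \<partial>M)"
  proof -
    have "((\<integral>\<omega>. f n \<omega> \<partial>M) - (\<integral>\<omega>. g \<omega> \<partial>M))\<^sup>2 \<le> (\<integral>\<omega>. (g \<omega> - f n \<omega>)\<^sup>2 \<partial>M)" for n
    proof -
      \<comment> \<open>The variance of \<open>g - f n\<close> being nonnegative bounds the squared
        difference of the means by the L^2 distance.\<close>
      have "0 \<le> variance (\<lambda>\<omega>. g \<omega> - f n \<omega>)" by (rule variance_positive)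
      also have "\<dots> = (\<integral>\<omega>. (g \<omega> - f n \<omega>)\<^sup>2 \<partial>M) - (\<integral>\<omega>. g \<omega> - f n \<omega> \<partial>M)\<^sup>2"
        using gi fi gd2 by (intro variance_eq) auto
      finally show ?thesis using gi fi by (simp add: power2_commute)
    qed
    then have "(\<lambda>n. ((\<integral>\<omega>. f n \<omega> \<partial>M) - (\<integral>\<omega>. g \<omega> \<partial>M))\<^sup>2) \<longlonglongrightarrow> 0"
      by (intro tendsto_sandwich[OF _ _ tendsto_const gd_lim]) auto
    from tendsto_real_sqrt[OF this] show ?thesis
      by (simp add: tendsto_rabs_zero_iff LIM_zero_iff)
  qed
  show "(\<lambda>n. \<integral>\<omega>. (f n \<omega>)\<^sup>2 \<partial>M) \<longlonglongrightarrow> (\<integral>\<omega>. (g \<omega>)\<^sup>2 \<partial>M)"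
  proof (rule LIMSEQ_I)
    fix r :: real assume "0 < r"
    define G where "G = (\<integral>\<omega>. (g \<omega>)\<^sup>2 \<partial>M)"
    \<comment> \<open>The choice makes \<open>s * G\<close> at most \<open>r / 2\<close>; the
      summand 1 covers the case \<open>G = 0\<close>.\<close>
    define s where "s = r / (2 * (1 + G))"
    have "0 \<le> G" by (simp add: G_def)
    then have "0 < s" using \<open>0 < r\<close> by (simp add: s_def)
    have "s * G \<le> r / 2"
      using \<open>0 \<le> G\<close> \<open>0 < r\<close> by (simp add: s_def field_simps)
    have b: "\<bar>(\<integral>\<omega>. (f n \<omega>)\<^sup>2 \<partial>M) - G\<bar> \<le> (1 + 1 / s) * (\<integral>\<omega>. (g \<omega> - f n \<omega>)\<^sup>2 \<partial>M) + s * G" for n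
    proof -
      have "\<bar>(\<integral>\<omega>. (f n \<omega>)\<^sup>2 \<partial>M) - G\<bar> = \<bar>\<integral>\<omega>. (f n \<omega>)\<^sup>2 - (g \<omega>)\<^sup>2 \<partial>M\<bar>"
        using f2 g2 by (simp add: G_def)
      also have "\<dots> \<le> (\<integral>\<omega>. \<bar>(f n \<omega>)\<^sup>2 - (g \<omega>)\<^sup>2\<bar> \<partial>M)"
        by (rule integral_abs_bound)
      also have "\<dots> \<le> (\<integral>\<omega>. (1 + 1 / s) * (g \<omega> - f n \<omega>)\<^sup>2 + s * (g \<omega>)\<^sup>2 \<partial>M)"
        using f2 g2 gd2 abs_diff_squares_le[OF \<open>0 < s\<close>]
        by (intro integral_mono) (auto simp: power2_commute[of "g _"])
      also have "\<dots> = (1 + 1 / s) * (\<integral>\<omega>. (g \<omega> - f n \<omega>)\<^sup>2 \<partial>M) + s * G"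
        using g2 gd2 by (simp add: G_def)
      finally show ?thesis .
    qed
    have "(\<lambda>n. (1 + 1 / s) * (\<integral>\<omega>. (g \<omega> - f n \<omega>)\<^sup>2 \<partial>M)) \<longlonglongrightarrow> 0"
      using gd_lim by (rule tendsto_mult_right_zero)
    then obtain no where no: "\<And>n. n \<ge> no \<Longrightarrow> \<bar>(1 + 1 / s) * (\<integral>\<omega>. (g \<omega> - f n \<omega>)\<^sup>2 \<partial>M)\<bar> < r / 2"
      using LIMSEQ_D[of _ 0 "r / 2"] \<open>0 < r\<close> by force
    then have "norm ((\<integral>\<omega>. (f n \<omega>)\<^sup>2 \<partial>M) - (\<integral>\<omega>. (g \<omega>)\<^sup>2 \<partial>M)) < r" if "n \<ge> no" for n
      using b[of n] \<open>s * G \<le> r / 2\<close> no[OF that] unfolding G_def real_norm_def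
      by linarith
    then show "\<exists>no. \<forall>n\<ge>no. norm ((\<integral>\<omega>. (f n \<omega>)\<^sup>2 \<partial>M) - (\<integral>\<omega>. (g \<omega>)\<^sup>2 \<partial>M)) < r"
      by blast
  qed
qed

end

section \<open>Recursions with summable perturbations\<close>

text \<open>Adding the tail of the convergent series of perturbations to \<open>r\<close> turns the recursion
  into averaging with a null sequence.\<close>

lemma perturbed_contraction_tendsto_0:
  fixes r x \<rho> G :: "nat \<Rightarrow> real"
  assumes rec: "eventually (\<lambda>n. r (Suc n) = \<rho> n * r n + x (Suc n)) sequentially"
    and x: "summable x"
    and \<rho>: "eventually (\<lambda>n. 0 \<le> \<rho> n \<and> \<rho> n \<le> 1 \<and> 0 < G n \<and> \<rho> n * G (Suc n) \<le> G n) sequentially"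
    and G: "filterlim G at_top sequentially"
  shows "r \<longlonglongrightarrow> 0"
proof -
  define t where "t n = (\<Sum>k. x (k + Suc n))" for n
  define q where "q n = r n + t n" for n
  have t0: "t \<longlonglongrightarrow> 0"
    using suminf_exist_split2[OF x] unfolding t_def[abs_def]
    by (rule filterlim_compose) (rule filterlim_Suc)
  have t_Suc: "t n = x (Suc n) + t (Suc n)" for n
    using suminf_split_head[OF summable_ignore_initial_segment[OF x, of "Suc n"]]
    by (simp add: t_def)
  obtain N where N: "\<And>n. n \<ge> N \<Longrightarrow> r (Suc n) = \<rho> n * r n + x (Suc n)"
      "\<And>n. n \<ge> N \<Longrightarrow> 0 \<le> \<rho> n \<and> \<rho> n \<le> 1 \<and> 0 < G n \<and> \<rho> n * G (Suc n) \<le> G n"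
    using eventually_conj[OF rec \<rho>] unfolding eventually_sequentially by blast
  have q_Suc: "q (Suc n) = \<rho> n * q n + (1 - \<rho> n) * t n" if "n \<ge> N" for n
    using N(1)[OF that] t_Suc[of n] by (simp add: q_def algebra_simps)
  have "q \<longlonglongrightarrow> 0"
  proof (rule LIMSEQ_I)
    fix e :: real assume "0 < e"
    obtain N' where N': "\<And>n. n \<ge> N' \<Longrightarrow> \<bar>t n\<bar> < e / 2"
      using LIMSEQ_D[OF t0, of "e / 2"] \<open>0 < e\<close> by auto
    define K where "K = max N N'"
    \<comment> \<open>From \<open>K\<close> on, \<open>t\<close> is below \<open>e / 2\<close>, so
      the excess of the modulus of \<open>q\<close> over \<open>e / 2\<close> shrinks by the factor
      \<open>\<rho> n\<close> in each step. These factors are at most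
      \<open>G n / G (Suc n)\<close>, whose product telescopes to \<open>G K / G n\<close>.\<close>
    have bound: "\<bar>q n\<bar> - e / 2 \<le> \<bar>q K\<bar> * G K / G n" if "n \<ge> K" for n
      using that
    proof (induction n rule: dec_induct)
      case base
      have "0 < G K" using N(2)[of K] by (simp add: K_def)
      then show ?case using \<open>0 < e\<close> by simp
    next
      case (step n)
      then have n: "n \<ge> N" "n \<ge> N'" by (auto simp: K_def)
      note \<rho>n = N(2)[OF n(1)]
      have "\<bar>q (Suc n)\<bar> \<le> \<bar>\<rho> n * q n\<bar> + \<bar>(1 - \<rho> n) * t n\<bar>"
        unfolding q_Suc[OF n(1)] by (rule abs_triangle_ineq)
      also have "\<dots> \<le> \<rho> n * \<bar>q n\<bar> + (1 - \<rho> n) * (e / 2)"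
        using \<rho>n mult_left_mono[OF less_imp_le[OF N'[OF n(2)]], of "1 - \<rho> n"] by (simp add: abs_mult)
      finally have "\<bar>q (Suc n)\<bar> - e / 2 \<le> \<rho> n * (\<bar>q n\<bar> - e / 2)"
        by (simp only: right_diff_distrib left_diff_distrib)
      also have "\<dots> \<le> \<rho> n * (\<bar>q K\<bar> * G K / G n)"
        using \<rho>n step by (intro mult_left_mono) auto
      also have "\<dots> = (\<bar>q K\<bar> * G K) * (\<rho> n / G n)" by simp
      also have "\<dots> \<le> (\<bar>q K\<bar> * G K) * (1 / G (Suc n))"
      proof (rule mult_left_mono)
        show "\<rho> n / G n \<le> 1 / G (Suc n)"
          using \<rho>n N(2)[of "Suc n"] n by (simp add: field_simps)
        show "0 \<le> \<bar>q K\<bar> * G K"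
          using N(2)[of K] by (simp add: K_def)
      qed
      finally show ?case by simp
    qed
    have "(\<lambda>n. \<bar>q K\<bar> * G K / G n) \<longlonglongrightarrow> 0"
      using G by (intro tendsto_divide_0[OF tendsto_const] filterlim_at_top_imp_at_infinity)
    from LIMSEQ_D[OF this, of "e / 2"] \<open>0 < e\<close>
    obtain L where L: "\<And>n. n \<ge> L \<Longrightarrow> \<bar>\<bar>q K\<bar> * G K / G n\<bar> < e / 2"
      by auto
    have "\<bar>q n\<bar> < e" if "n \<ge> max K L" for n
      using bound[of n] L[of n] that by linarith
    then show "\<exists>no. \<forall>n\<ge>no. norm (q n - 0) < e" by (intro exI[of _ "max K L"]) auto
  qed
  from tendsto_diff[OF this t0] show ?thesis by (simp add: q_def)
qed

text \<open>\<open>G\<close> measures how much faster the normalising sequence \<open>c\<close> grows than the products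
  of the factors \<open>1 + a / n\<close>.\<close>

lemma normalised_tendsto_0:
  fixes s \<epsilon> c G :: "nat \<Rightarrow> real"
  assumes rec: "\<And>n. n \<ge> 1 \<Longrightarrow> s (Suc n) = (1 + a / real n) * s n + \<epsilon> (Suc n)"
    and a: "- 1 \<le> a"
    and sum: "summable (\<lambda>n. \<epsilon> n / c n)"
    and c: "eventually (\<lambda>n. 0 < c n) sequentially"
    and G: "filterlim G at_top sequentially" "incseq G"
    and growth: "eventually (\<lambda>n. (1 + a / real n) * c n * G (Suc n) \<le> G n * c (Suc n)) sequentially"
  shows "(\<lambda>n. s n / c n) \<longlonglongrightarrow> 0"
proof (rule perturbed_contraction_tendsto_0)
  define \<rho> where "\<rho> n = (1 + a / real n) * c n / c (Suc n)" for n
  have c': "eventually (\<lambda>n. 0 < c (Suc n)) sequentially"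
    using c by (rule eventually_compose_filterlim) (rule filterlim_Suc)
  have G0: "eventually (\<lambda>n. 0 < G n) sequentially"
    using G(1) by (simp add: filterlim_at_top_dense)
  show "eventually (\<lambda>n. s (Suc n) / c (Suc n) = \<rho> n * (s n / c n) + \<epsilon> (Suc n) / c (Suc n)) sequentially"
    using c c' eventually_ge_at_top[of 1]
    by eventually_elim (simp add: rec \<rho>_def add_divide_distrib)
  show "eventually (\<lambda>n. 0 \<le> \<rho> n \<and> \<rho> n \<le> 1 \<and> 0 < G n \<and> \<rho> n * G (Suc n) \<le> G n) sequentially"
    using c c' G0 growth eventually_ge_at_top[of 1]
  proof eventually_elim
    case (elim n)
    have "0 \<le> 1 + a / real n" using elim a by (simp add: field_simps)
    then have 0: "0 \<le> \<rho> n" using elim by (simp add: \<rho>_def)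
    have le: "\<rho> n * G (Suc n) \<le> G n" using elim by (simp add: \<rho>_def field_simps)
    \<comment> \<open>Monotonicity of \<open>G\<close> turns the growth bound into
      \<open>\<rho> n \<le> 1\<close>.\<close>
    have "G n \<le> G (Suc n)" using G(2) by (simp add: incseq_Suc_iff)
    then have "\<rho> n * G (Suc n) \<le> 1 * G (Suc n)" using le by linarith
    then have "\<rho> n \<le> 1"
      using elim(3) \<open>G n \<le> G (Suc n)\<close> by (subst (asm) mult_le_cancel_right_pos) auto
    then show ?case using 0 le elim by simp
  qed
qed (use sum G in auto)

section \<open>Logarithmic weights\<close>

lemma summable_of_telescoping_bound:
  fixes f h :: "nat \<Rightarrow> real"
  assumes h: "h \<longlonglongrightarrow> 0" and le: "eventually (\<lambda>n. norm (f n) \<le> C * (h n - h (Suc n))) sequentially"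
  shows "summable f"
proof -
  have "summable (\<lambda>n. C * (h n - h (Suc n)))"
    using telescope_summable'[OF h] by (rule summable_mult)
  then show ?thesis
    using le by (rule summable_comparison_test_ev[rotated])
qed

text \<open>An integral test in telescoping form: 1 / (x (log x)^(1 + 2 \<delta>)) is the derivative
  of -(log x)^(-2 \<delta>) / (2 \<delta>). The constant \<open>1 / \<delta>\<close> is twice the
  coefficient 1 / (2 \<delta>), which leaves room for replacing the derivative by a
  difference.\<close>

lemma summable_inverse_log_weight:
  fixes \<delta> :: real
  assumes "0 < \<delta>"
  shows "summable (\<lambda>n. 1 / (sqrt (real n) * ln (real n) powr (1 / 2 + \<delta>))\<^sup>2)"
proof (rule summable_of_telescoping_bound)
  let ?h = "\<lambda>n. ln (real n) powr (- 2 * \<delta>)"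
  show "?h \<longlonglongrightarrow> 0" using assms by real_asymp
  have "eventually (\<lambda>n. 1 / (real n * ln (real n) powr (1 + 2 * \<delta>)) \<le>
      (1 / \<delta>) * (ln (real n) powr (- 2 * \<delta>) - ln (real n + 1) powr (- 2 * \<delta>))) sequentially"
    using assms by real_asymp
  then show "eventually (\<lambda>n. norm (1 / (sqrt (real n) * ln (real n) powr (1 / 2 + \<delta>))\<^sup>2)
      \<le> (1 / \<delta>) * (?h n - ?h (Suc n))) sequentially"
  proof eventually_elim
    case (elim n)
    have "(ln (real n) powr (1 / 2 + \<delta>))\<^sup>2 = ln (real n) powr (1 + 2 * \<delta>)"
      by (simp add: power2_eq_square powr_add[symmetric] algebra_simps)
    then show ?case using elim by (simp add: power_mult_distrib add.commute)
  qed
qed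

text \<open>The same comparison, now with the antiderivative -(log log x)^(-2 \<delta>) / (2
  \<delta>) of 1 / (x log x (log log x)^(1 + 2 \<delta>)).\<close>

lemma summable_inverse_loglog_weight:
  fixes \<delta> :: real
  assumes "0 < \<delta>"
  shows "summable (\<lambda>n. 1 / (sqrt (real n) * (sqrt (ln (real n)) * ln (ln (real n)) powr (1 / 2 + \<delta>)))\<^sup>2)"
proof (rule summable_of_telescoping_bound)
  let ?h = "\<lambda>n. ln (ln (real n)) powr (- 2 * \<delta>)"
  show "?h \<longlonglongrightarrow> 0" using assms by real_asymp
  have "eventually (\<lambda>n. 1 / (real n * ln (real n) * ln (ln (real n)) powr (1 + 2 * \<delta>)) \<le>
      (1 / \<delta>) * (ln (ln (real n)) powr (- 2 * \<delta>) - ln (ln (real n + 1)) powr (- 2 * \<delta>))) sequentially"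
    using assms by real_asymp
  moreover have "eventually (\<lambda>n. 0 < ln (real n)) sequentially" by real_asymp
  ultimately show "eventually (\<lambda>n. norm (1 / (sqrt (real n) * (sqrt (ln (real n)) * ln (ln (real n)) powr (1 / 2 + \<delta>)))\<^sup>2)
      \<le> (1 / \<delta>) * (?h n - ?h (Suc n))) sequentially"
  proof eventually_elim
    case (elim n)
    have "(ln (ln (real n)) powr (1 / 2 + \<delta>))\<^sup>2 = ln (ln (real n)) powr (1 + 2 * \<delta>)"
      by (simp add: power2_eq_square powr_add[symmetric] algebra_simps)
    then show ?case using elim by (simp add: power_mult_distrib add.commute mult.assoc)
  qed
qed

lemma log_normalised_tendsto_0:
  fixes s \<epsilon> :: "nat \<Rightarrow> real"
  assumes rec: "\<And>n. n \<ge> 1 \<Longrightarrow> s (Suc n) = (1 + a / real n) * s n + \<epsilon> (Suc n)"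
    and a: "- 1 \<le> a" "a < 1 / 2" and \<delta>: "0 < \<delta>"
    and sum: "summable (\<lambda>n. \<epsilon> n / (sqrt (real n) * ln (real n) powr (1 / 2 + \<delta>)))"
  shows "(\<lambda>n. s n / (sqrt (real n) * ln (real n) powr (1 / 2 + \<delta>))) \<longlonglongrightarrow> 0"
proof (rule normalised_tendsto_0[OF rec a(1) sum])
  define b where "b = 1 / 2 - a"
  have b: "0 < b" "a = 1 / 2 - b" using a by (auto simp: b_def)
  \<comment> \<open>The weight outgrows the products of 1 + a / n at least by the power
    \<open>b\<close> of n. Using only half of it leaves a slack of order b / (2 n) in each step,
    which absorbs the errors of second order; of the logarithm only monotonicity is used.\<close>
  let ?G = "\<lambda>n. real n powr (b / 2)"
  show "eventually (\<lambda>n. 0 < sqrt (real n) * ln (real n) powr (1 / 2 + \<delta>)) sequentially"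
    by real_asymp
  show "filterlim ?G at_top sequentially" using b(1) by real_asymp
  show "incseq ?G" using b(1) by (auto simp: incseq_def intro!: powr_mono2)
  have "eventually (\<lambda>n. (1 + (1 / 2 - b) / real n) * sqrt (real n) * (real n + 1) powr (b / 2)
      \<le> real n powr (b / 2) * sqrt (real n + 1)) sequentially"
    using b(1) by real_asymp
  then show "eventually (\<lambda>n. (1 + a / real n) * (sqrt (real n) * ln (real n) powr (1 / 2 + \<delta>)) * ?G (Suc n)
      \<le> ?G n * (sqrt (real (Suc n)) * ln (real (Suc n)) powr (1 / 2 + \<delta>))) sequentially"
    using eventually_gt_at_top[of 1]
  proof eventually_elim
    case (elim n)
    have "ln (real n) powr (1 / 2 + \<delta>) \<le> ln (real n + 1) powr (1 / 2 + \<delta>)"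
      using elim \<delta> by (intro powr_mono2) auto
    from mult_mono[OF elim(1) this] show ?case
      by (simp add: b(2) mult_ac add.commute)
  qed
qed

lemma loglog_normalised_tendsto_0:
  fixes s \<epsilon> :: "nat \<Rightarrow> real"
  assumes rec: "\<And>n. n \<ge> 1 \<Longrightarrow> s (Suc n) = (1 + (1 / 2) / real n) * s n + \<epsilon> (Suc n)"
    and \<delta>: "0 < \<delta>"
    and sum: "summable (\<lambda>n. \<epsilon> n / (sqrt (real n) * (sqrt (ln (real n)) * ln (ln (real n)) powr (1 / 2 + \<delta>))))"
  shows "(\<lambda>n. s n / (sqrt (real n) * (sqrt (ln (real n)) * ln (ln (real n)) powr (1 / 2 + \<delta>)))) \<longlonglongrightarrow> 0"
proof (rule normalised_tendsto_0[OF rec _ sum])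
  show "- 1 \<le> (1 / 2 :: real)" by simp
  \<comment> \<open>At a = 1/2 the factor \<open>sqrt n\<close> has no power to spare, and the room
    comes from \<open>sqrt (ln n)\<close>, half of which is used. The maximum with 1 makes the
    sequence monotone from index 0 on.\<close>
  let ?G = "\<lambda>n. sqrt (sqrt (ln (real (max 1 n))))"
  show "eventually (\<lambda>n. 0 < sqrt (real n) * (sqrt (ln (real n)) * ln (ln (real n)) powr (1 / 2 + \<delta>))) sequentially"
    by real_asymp
  have "filterlim (\<lambda>n. sqrt (sqrt (ln (real n)))) at_top sequentially" by real_asymp
  moreover have "eventually (\<lambda>n. sqrt (sqrt (ln (real n))) = ?G n) sequentially"
    using eventually_ge_at_top[of 1] by eventually_elim (simp add: max_def)
  ultimately show "filterlim ?G at_top sequentially"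
    by (rule filterlim_cong[OF refl refl, THEN iffD1, rotated])
  show "incseq ?G"
    by (auto simp: incseq_def max_def)
  \<comment> \<open>The factor 1 + 1 / (2 n) exceeds sqrt (1 + 1 / n) only by order 1 / n^2, whereas
    the fourth root of the logarithm gains about 1 / (4 n log n).\<close>
  have "eventually (\<lambda>n. (1 + (1 / 2) / real n) * sqrt (real n) * sqrt (sqrt (ln (real n)))
      \<le> sqrt (real n + 1) * sqrt (sqrt (ln (real n + 1)))) sequentially"
    by real_asymp
  then show "eventually (\<lambda>n. (1 + (1 / 2) / real n) * (sqrt (real n) * (sqrt (ln (real n)) * ln (ln (real n)) powr (1 / 2 + \<delta>))) * ?G (Suc n)
      \<le> ?G n * (sqrt (real (Suc n)) * (sqrt (ln (real (Suc n))) * ln (ln (real (Suc n))) powr (1 / 2 + \<delta>)))) sequentially"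
    using eventually_ge_at_top[of 3]
  proof eventually_elim
    case (elim n)
    \<comment> \<open>From 3 on the iterated logarithm is nonnegative, as monotonicity of
      \<open>powr\<close> in its base requires.\<close>
    have "exp 1 \<le> real n" using exp_le elim by linarith
    then have "1 \<le> ln (real n)" using elim by (subst ln_ge_iff) auto
    then have w: "ln (ln (real n)) powr (1 / 2 + \<delta>) \<le> ln (ln (real n + 1)) powr (1 / 2 + \<delta>)"
      using elim \<delta> by (intro powr_mono2) auto
    \<comment> \<open>In terms of the fourth roots both sides of the goal contain the factor
      \<open>x * y\<close>; without it the goal is the asymptotic inequality above, multiplied by
      the iterated logarithms.\<close>
    define x y where "x = sqrt (sqrt (ln (real n)))" and "y = sqrt (sqrt (ln (real n + 1)))"
    have xy: "sqrt (ln (real n)) = x * x" "sqrt (ln (real n + 1)) = y * y" "0 \<le> x" "0 \<le> y"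
      using elim by (auto simp: x_def y_def)
    have "(1 + (1 / 2) / real n) * sqrt (real n) * x \<le> sqrt (real n + 1) * y"
      using elim(1) by (simp only: x_def y_def)
    then have "((1 + (1 / 2) / real n) * sqrt (real n) * x) * ln (ln (real n)) powr (1 / 2 + \<delta>)
        \<le> (sqrt (real n + 1) * y) * ln (ln (real n + 1)) powr (1 / 2 + \<delta>)"
      using w xy by (intro mult_mono[of "_ * x"]) auto
    then have "((1 + (1 / 2) / real n) * sqrt (real n) * x) * ln (ln (real n)) powr (1 / 2 + \<delta>) * (x * y)
        \<le> (sqrt (real n + 1) * y) * ln (ln (real n + 1)) powr (1 / 2 + \<delta>) * (x * y)"
      using xy by (intro mult_right_mono) auto
    moreover have "?G n = x" "?G (Suc n) = y" "real (Suc n) = real n + 1"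
      using elim by (auto simp: x_def y_def max_def add.commute)
    ultimately show ?case
      by (simp only: xy(1,2) mult_ac)
  qed
qed

section \<open>Ratios of Gamma values\<close>

lemma Gamma_ratio_asymptotic:
  fixes z :: real
  assumes "0 < z"
  shows "(\<lambda>n. Gamma (real n + z) / Gamma (real n) / real n powr z) \<longlonglongrightarrow> 1"
proof -
  have z: "z \<notin> \<int>\<^sub>\<le>\<^sub>0" using assms by (auto elim!: nonpos_Ints_cases)
  \<comment> \<open>This is Euler's limit for \<open>Gamma z\<close>, read backwards: the Pochhammer
    symbol in its denominator is \<open>Gamma (z + n) / Gamma z\<close>.\<close>
  have "(\<lambda>n. Gamma z / Gamma_series' z n) \<longlonglongrightarrow> Gamma z / Gamma z"
    using z by (intro tendsto_divide tendsto_const Gamma_series'_LIMSEQ) (simp add: Gamma_eq_zero_iff)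
  moreover have "Gamma z / Gamma z = 1"
    using z by (simp add: Gamma_eq_zero_iff)
  moreover have "eventually (\<lambda>n. Gamma z / Gamma_series' z n =
      Gamma (real n + z) / Gamma (real n) / real n powr z) sequentially"
    using eventually_gt_at_top[of 0]
  proof eventually_elim
    case (elim n)
    have "Gamma (real n) = fact (n - 1)"
      using elim by (metis Gamma_fact Suc_pred' of_nat_Suc)
    moreover have "pochhammer z n = Gamma (z + real n) / Gamma z"
      using z by (rule pochhammer_Gamma)
    moreover have "Gamma z \<noteq> 0" using z by (simp add: Gamma_eq_zero_iff)
    ultimately show ?case
      using elim by (simp add: Gamma_series'_def powr_def add.commute)
  qed
  ultimately show ?thesis by (simp add: tendsto_cong)
qed

text \<open>For positive \<open>z\<close> this is \<open>Gamma (z + 1)\<close> times the product of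
  1 + z / k over 1 \<le> k < n. It serves with \<open>z = a\<close> as the normalisation of the walk
  and with \<open>z = 2 * a\<close> as the homogeneous solution for the second moments.\<close>

definition growth :: "real \<Rightarrow> nat \<Rightarrow> real" where
  "growth z n = Gamma (real n + z) / Gamma (real n)"

lemma growth_pos: "0 < z \<Longrightarrow> 1 \<le> n \<Longrightarrow> 0 < growth z n"
  unfolding growth_def by (intro divide_pos_pos Gamma_real_pos) auto

lemma growth_1: "growth z 1 = Gamma (z + 1)"
  by (simp add: growth_def add.commute)

lemma growth_Suc:
  assumes "0 < z" "1 \<le> n"
  shows "growth z (Suc n) = (1 + z / real n) * growth z n"
proof -
  have "Gamma (real n + z + 1) = (real n + z) * Gamma (real n + z)"
    using assms by (intro Gamma_plus1) (auto elim!: nonpos_Ints_cases)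
  moreover have "Gamma (real n + 1) = real n * Gamma (real n)"
    using assms by (intro Gamma_plus1) (auto elim!: nonpos_Ints_cases)
  moreover have "0 < Gamma (real n)"
    by (rule Gamma_real_pos) (use assms in simp)
  ultimately show ?thesis
    using assms by (simp add: growth_def field_simps)
qed

lemma growth_asymptotic: "0 < z \<Longrightarrow> (\<lambda>n. growth z n / real n powr z) \<longlonglongrightarrow> 1"
  unfolding growth_def by (rule Gamma_ratio_asymptotic)

lemma inverse_growth_asymptotic: "0 < z \<Longrightarrow> (\<lambda>n. real n powr z / growth z n) \<longlonglongrightarrow> 1"
  using tendsto_inverse[OF growth_asymptotic, of z] by (simp add: field_simps)

section \<open>Independence and the past of the walk\<close>

context prob_space
begin

definition generated :: "('i \<Rightarrow> 'a \<Rightarrow> real) \<Rightarrow> 'i set \<Rightarrow> 'a measure" where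
  "generated Y J = sigma (space M) (\<Union>j\<in>J. {Y j -` A \<inter> space M | A. A \<in> sets borel})"

lemma space_generated [simp]: "space (generated Y J) = space M"
  unfolding generated_def by (rule space_measure_of) auto

lemma sets_generated:
  "sets (generated Y J) = sigma_sets (space M) (\<Union>j\<in>J. {Y j -` A \<inter> space M | A. A \<in> sets borel})"
  unfolding generated_def by (rule sets_measure_of) auto

lemma generated_mono: "J \<subseteq> K \<Longrightarrow> subalgebra (generated Y K) (generated Y J)"
  unfolding subalgebra_def sets_generated by (auto intro!: sigma_sets_mono')

lemma subalgebra_generated:
  assumes "\<And>j. j \<in> J \<Longrightarrow> Y j \<in> borel_measurable M"
  shows "subalgebra M (generated Y J)"
  unfolding subalgebra_def sets_generated
  using assms by (auto intro!: sets.sigma_sets_subset measurable_sets)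

lemma measurable_generated: "j \<in> J \<Longrightarrow> Y j \<in> borel_measurable (generated Y J)"
  by (rule measurableI) (auto simp: sets_generated intro!: sigma_sets.Basic)

lemma measurable_generated_mono:
  "f \<in> borel_measurable (generated Y J) \<Longrightarrow> J \<subseteq> K \<Longrightarrow> f \<in> borel_measurable (generated Y K)"
  using measurable_from_subalg[OF generated_mono] .

text \<open>Disjoint blocks of an independent family generate independent sigma-algebras, and
  \<open>f\<close> and \<open>g\<close> each read one block. Every later factorisation of an
  expectation goes through this fact.\<close>

lemma indep_var_generated:
  assumes indep: "indep_vars (\<lambda>_. borel) Y I" and AB: "A \<inter> B = {}" "A \<subseteq> I" "B \<subseteq> I"
    and f: "f \<in> borel_measurable (generated Y A)" and g: "g \<in> borel_measurable (generated Y B)"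
  shows "indep_var borel f borel g"
proof -
  let ?E = "\<lambda>j. {Y j -` X \<inter> space M | X. X \<in> sets borel}"
  have Y: "\<And>i. i \<in> I \<Longrightarrow> Y i \<in> borel_measurable M" and E: "indep_sets ?E I"
    using indep unfolding indep_vars_def2 by auto
  have "indep_sets (\<lambda>j. sigma_sets (space M) (\<Union>i\<in>case_bool A B j. ?E i)) UNIV"
  proof (rule indep_sets_collect_sigma)
    show "indep_sets ?E (\<Union>j\<in>UNIV. case_bool A B j)"
      using E AB by (auto intro: indep_sets_mono_index simp: UNIV_bool)
    show "Int_stable (?E i)" for i
    proof (rule Int_stableI)
      fix a b assume "a \<in> ?E i" "b \<in> ?E i"
      then obtain X Z where "a = Y i -` X \<inter> space M" "X \<in> sets borel" "b = Y i -` Z \<inter> space M" "Z \<in> sets borel"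
        by auto
      then have "a \<inter> b = Y i -` (X \<inter> Z) \<inter> space M" "X \<inter> Z \<in> sets borel" by auto
      then show "a \<inter> b \<in> ?E i" by blast
    qed
    show "disjoint_family_on (case_bool A B) UNIV"
      using AB by (auto simp: disjoint_family_on_def split: bool.split)
  qed
  then have *: "indep_sets (\<lambda>j. sets (generated Y (case_bool A B j))) UNIV"
    by (simp add: sets_generated)
  have "indep_vars (case_bool borel borel) (case_bool f g) UNIV"
    unfolding indep_vars_def2
  proof (intro conjI ballI)
    have "f \<in> borel_measurable M"
      by (rule measurable_from_subalg[OF subalgebra_generated f]) (use AB Y in auto)
    moreover have "g \<in> borel_measurable M"
      by (rule measurable_from_subalg[OF subalgebra_generated g]) (use AB Y in auto)
    ultimately show "case_bool f g i \<in> measurable M (case_bool borel borel i)" for i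
      by (cases i) simp_all
    show "indep_sets (\<lambda>i. {case_bool f g i -` X \<inter> space M | X. X \<in> sets (case_bool borel borel i)}) UNIV"
      using *
    proof (rule indep_sets_mono_sets)
      fix i :: bool
      show "{case_bool f g i -` X \<inter> space M | X. X \<in> sets (case_bool borel borel i)}
          \<subseteq> sets (generated Y (case_bool A B i))"
        using measurable_sets[OF f] measurable_sets[OF g] by (auto split: bool.split)
    qed
  qed
  then show ?thesis unfolding indep_var_def .
qed

lemma expectation_mult_generated:
  fixes f g :: "'a \<Rightarrow> real"
  assumes "indep_vars (\<lambda>_. borel) Y I" and "A \<inter> B = {}" "A \<subseteq> I" "B \<subseteq> I"
    and "f \<in> borel_measurable (generated Y A)" "g \<in> borel_measurable (generated Y B)"
    and "integrable M f" "integrable M g"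
  shows "integrable M (\<lambda>\<omega>. f \<omega> * g \<omega>)"
    and "expectation (\<lambda>\<omega>. f \<omega> * g \<omega>) = expectation f * expectation g"
  using indep_var_integrable[OF indep_var_generated[OF assms(1-6)] assms(7,8)]
    indep_var_lebesgue_integral[OF indep_var_generated[OF assms(1-6)] assms(7,8)] by auto

lemma prob_indicator:
  assumes "{\<omega>\<in>space M. P \<omega>} \<in> events"
  shows "integrable M (\<lambda>\<omega>. if P \<omega> then 1 else 0 :: real)"
    and "expectation (\<lambda>\<omega>. if P \<omega> then 1 else 0) = prob {\<omega>\<in>space M. P \<omega>}"
proof -
  have *: "integrable M (indicator {\<omega>\<in>space M. P \<omega>} :: 'a \<Rightarrow> real)"
    using assms by (simp add: integrable_indicator_iff emeasure_eq_measure)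
  have "integrable M (\<lambda>\<omega>. if P \<omega> then 1 else 0 :: real) = integrable M (indicator {\<omega>\<in>space M. P \<omega>} :: 'a \<Rightarrow> real)"
    by (rule Bochner_Integration.integrable_cong) (auto simp: indicator_def)
  with * show "integrable M (\<lambda>\<omega>. if P \<omega> then 1 else 0 :: real)" by simp
  have "expectation (\<lambda>\<omega>. if P \<omega> then 1 else 0) = expectation (indicator {\<omega>\<in>space M. P \<omega>})"
    by (rule Bochner_Integration.integral_cong) (auto simp: indicator_def)
  also have "\<dots> = prob {\<omega>\<in>space M. P \<omega>}" using assms by simp
  finally show "expectation (\<lambda>\<omega>. if P \<omega> then 1 else 0) = prob {\<omega>\<in>space M. P \<omega>}" .
qed

lemma AE_two_valued:
  fixes f :: "'a \<Rightarrow> real"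
  assumes [measurable]: "f \<in> borel_measurable M" and "x \<noteq> y"
    and "prob {\<omega>\<in>space M. f \<omega> = x} + prob {\<omega>\<in>space M. f \<omega> = y} = 1"
  shows "AE \<omega> in M. f \<omega> = x \<or> f \<omega> = y"
proof -
  have "prob {\<omega>\<in>space M. f \<omega> = x \<or> f \<omega> = y} = prob ({\<omega>\<in>space M. f \<omega> = x} \<union> {\<omega>\<in>space M. f \<omega> = y})"
    by (rule arg_cong[where f = prob]) auto
  also have "\<dots> = prob {\<omega>\<in>space M. f \<omega> = x} + prob {\<omega>\<in>space M. f \<omega> = y}"
    using assms(2) by (intro finite_measure_Union) auto
  finally have "prob {\<omega>\<in>space M. f \<omega> = x \<or> f \<omega> = y} = 1"
    using assms(3) by simp
  from AE_prob_1[OF this] show ?thesis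
    by eventually_elim auto
qed

end

section \<open>The driving variables as one independent family, and the filtration\<close>

context step_reinforced_walk
begin

text \<open>The indices \<open>(0, n)\<close>, \<open>(1, n)\<close>, \<open>(2, n)\<close> and \<open>(3, n)\<close> stand for \<open>\<xi> n\<close>, \<open>U n\<close>, \<open>\<gamma> n\<close> and \<open>\<rho> n\<close>.\<close>

definition source :: "nat \<times> nat \<Rightarrow> 'a \<Rightarrow> real" where
  "source ij = ([\<xi>, \<lambda>n \<omega>. real (U n \<omega>), \<gamma>, \<rho>] ! fst ij) (snd ij)"

lemma source_simps [simp]:
  "source (0, n) = \<xi> n" "source (Suc 0, n) = (\<lambda>\<omega>. real (U n \<omega>))"
  "source (1, n) = (\<lambda>\<omega>. real (U n \<omega>))" "source (2, n) = \<gamma> n" "source (3, n) = \<rho> n"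
  by (simp_all add: source_def)

abbreviation source_indices :: "(nat \<times> nat) set" where
  "source_indices \<equiv> {..<4} \<times> {1..}"

lemma indep_source_row:
  assumes "i < 4"
  shows "indep_vars (\<lambda>_. borel) (\<lambda>n. source (i, n)) {1..}"
proof -
  have "indep_vars (\<lambda>_. borel) (\<lambda>n \<omega>. real (U n \<omega>)) {1..}"
    using U_indep by (rule indep_vars_compose2) auto
  moreover have "i = 0 \<or> i = 1 \<or> i = 2 \<or> i = 3" using assms by auto
  ultimately show ?thesis
    using \<xi>_indep \<gamma>_indep \<rho>_indep by auto
qed

lemma source_measurable:
  assumes "j \<in> source_indices"
  shows "source j \<in> borel_measurable M"
proof -
  obtain i n where j: "j = (i, n)" "i < 4" "n \<in> {1..}" using assms by auto
  show ?thesis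
    using indep_source_row[OF j(2)] j(3) unfolding indep_vars_def2 j(1) by blast
qed

text \<open>A finite index set splits into rows. Independence of the four sequences as random
  elements of the product space factors the probability over the rows, and independence within each
  sequence factors every row.\<close>

lemma indep_source: "indep_vars (\<lambda>_. borel) source source_indices"
  unfolding indep_vars_def2
proof (intro conjI ballI source_measurable indep_setsI)
  fix A J assume J: "J \<noteq> {}" "J \<subseteq> source_indices" "finite J"
    and A: "\<forall>j\<in>J. A j \<in> {source j -` B \<inter> space M |B. B \<in> sets borel}"
  then obtain B where B: "\<And>j. j \<in> J \<Longrightarrow> A j = source j -` B j \<inter> space M \<and> B j \<in> sets borel"
    by simp metis
  define R where "R = fst ` J"
  define K where "K i = {n. (i, n) \<in> J}" for i
  have JK: "J = Sigma R K" by (force simp: R_def K_def)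
  have R: "R \<noteq> {}" "finite R" "R \<subseteq> {..<4}" using J by (auto simp: R_def)
  have K: "K i \<subseteq> {1..}" "finite (K i)" for i
  proof -
    show "K i \<subseteq> {1..}" using J by (auto simp: K_def)
    have "K i \<subseteq> snd ` J" by (force simp: K_def)
    then show "finite (K i)" using J finite_surj by blast
  qed
  have K_ne: "K i \<noteq> {}" if "i \<in> R" for i using that by (auto simp: R_def K_def)
  let ?P = "Pi\<^sub>M {1..} (\<lambda>_. borel :: real measure)"
  let ?E = "\<lambda>i. \<Inter>n\<in>K i. A (i, n)"
  have row: "prob (?E i) = (\<Prod>n\<in>K i. prob (A (i, n)))" if "i \<in> R" for i
  proof (rule indep_setsD[where I = "{1..}"])
    show "indep_sets (\<lambda>n. {source (i, n) -` B \<inter> space M |B. B \<in> sets borel}) {1..}"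
      using indep_source_row[of i] R that unfolding indep_vars_def2 by auto
    show "\<forall>n\<in>K i. A (i, n) \<in> {source (i, n) -` B \<inter> space M |B. B \<in> sets borel}"
      using A by (auto simp: K_def)
  qed (use K K_ne that in auto)
  have "prob (\<Inter>i\<in>R. ?E i) = (\<Prod>i\<in>R. prob (?E i))"
  proof (rule indep_setsD[where I = "{..<4}"])
    let ?X = "\<lambda>i \<omega>. \<lambda>n\<in>{1..}. ([\<xi>, \<lambda>n \<omega>. real (U n \<omega>), \<gamma>, \<rho>] ! i) n \<omega>"
    show "indep_sets (\<lambda>i. {?X i -` C \<inter> space M |C. C \<in> sets ?P}) {..<4::nat}"
      using sequences_indep unfolding indep_vars_def2 by simp
    show "\<forall>i\<in>R. ?E i \<in> {?X i -` C \<inter> space M |C. C \<in> sets ?P}"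
    proof
      fix i assume i: "i \<in> R"
      \<comment> \<open>The event of one row constrains finitely many coordinates, so it is the
        preimage of a measurable cylinder under the whole sequence.\<close>
      define C where "C = {f \<in> space ?P. \<forall>n\<in>K i. f n \<in> B (i, n)}"
      have "C \<in> sets ?P"
        unfolding C_def
      proof (intro sets.sets_Collect_finite_All K)
        fix n assume n: "n \<in> K i"
        then have "(\<lambda>f. f n) \<in> borel_measurable ?P"
          using K by (intro measurable_component_singleton) auto
        from measurable_sets[OF this, of "B (i, n)"] B[of "(i, n)"] n
        show "{f \<in> space ?P. f n \<in> B (i, n)} \<in> sets ?P"
          by (simp add: K_def vimage_def Int_def conj_commute)
      qed
      moreover have "?E i = ?X i -` C \<inter> space M"
      proof -
        have "?X i \<omega> \<in> space ?P" for \<omega> by (auto simp: space_PiM)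
        moreover have "?X i \<omega> n = source (i, n) \<omega>" if "n \<in> K i" for n \<omega>
          using K that by (auto simp: source_def)
        ultimately show ?thesis
          using B K_ne[OF i] by (auto simp: C_def K_def)
      qed
      ultimately show "?E i \<in> {?X i -` C \<inter> space M |C. C \<in> sets ?P}" by blast
    qed
  qed (use R in auto)
  also have "(\<Inter>i\<in>R. ?E i) = (\<Inter>j\<in>J. A j)"
    by (auto simp: JK)
  also have "(\<Prod>i\<in>R. prob (?E i)) = (\<Prod>i\<in>R. \<Prod>n\<in>K i. prob (A (i, n)))"
    using row by (intro prod.cong) auto
  also have "\<dots> = (\<Prod>j\<in>J. prob (A j))"
    unfolding JK using R K by (subst prod.Sigma) auto
  finally show "prob (\<Inter>j\<in>J. A j) = (\<Prod>j\<in>J. prob (A j))" .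
qed (auto intro: measurable_sets[OF source_measurable])

text \<open>What the first \<open>n\<close> steps depend on: step \<open>n\<close> uses
  \<open>\<xi> n\<close>, but \<open>U\<close>, \<open>\<gamma>\<close> and \<open>\<rho>\<close>
  only at \<open>n - 1\<close>. So \<open>U n\<close>, \<open>\<gamma> n\<close>,
  \<open>\<rho> n\<close> and \<open>\<xi> (Suc n)\<close>, which produce the next step, are all
  outside.\<close>

definition past_indices :: "nat \<Rightarrow> (nat \<times> nat) set" where
  "past_indices n = {(i, j). i < 4 \<and> 1 \<le> j \<and> (if i = 0 then j \<le> n else j < n)}"

definition past :: "nat \<Rightarrow> 'a measure" where
  "past n = generated source (past_indices n)"

lemma past_indices_subset: "past_indices n \<subseteq> source_indices"
  by (auto simp: past_indices_def)

lemma subalgebra_past: "subalgebra M (past n)"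
  unfolding past_def using past_indices_subset
  by (intro subalgebra_generated source_measurable) auto

lemma past_mono: "m \<le> n \<Longrightarrow> subalgebra (past n) (past m)"
  unfolding past_def
  by (intro generated_mono) (auto simp: past_indices_def split: if_splits)

text \<open>\<open>\<gamma>\<close> and \<open>\<rho>\<close> are two-valued only almost surely. The
  versions \<open>repeat\<close> and \<open>sign\<close> are two-valued at every outcome, so that
  identities between squares hold pointwise.\<close>

definition repeat :: "nat \<Rightarrow> 'a \<Rightarrow> real" where
  "repeat n \<omega> = (if \<gamma> n \<omega> = 1 then 1 else 0)"

definition sign :: "nat \<Rightarrow> 'a \<Rightarrow> real" where
  "sign n \<omega> = (if \<rho> n \<omega> = 1 then 1 else - 1)"

text \<open>Summing over \<open>k\<close> separates the random index from the value found there, and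
  each summand becomes a product of independent factors.\<close>

definition select :: "nat \<Rightarrow> nat \<Rightarrow> 'a \<Rightarrow> real" where
  "select n k \<omega> = (if U n \<omega> = k then 1 else 0)"

lemma sum_select:
  "(\<Sum>k=1..n. select n k \<omega> * f k) = (if U n \<omega> \<in> {1..n} then f (U n \<omega>) else 0)"
proof -
  have "(\<Sum>k=1..n. select n k \<omega> * f k) = (\<Sum>k=1..n. if U n \<omega> = k then f k else 0)"
    by (intro sum.cong) (auto simp: select_def)
  then show ?thesis by (simp add: sum.delta)
qed

text \<open>A version of the steps that is measurable with respect to the past everywhere, not only
  up to null sets.\<close>

function step :: "nat \<Rightarrow> 'a \<Rightarrow> real" where
  "step n \<omega> = (if n \<le> 1 then \<xi> n \<omega> else
     (\<Sum>k=1..n - 1. select (n - 1) k \<omega> * (repeat (n - 1) \<omega> * (sign (n - 1) \<omega> * step k \<omega>)))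
       + (1 - repeat (n - 1) \<omega>) * \<xi> n \<omega>)"
  by auto
termination by (relation "Wellfounded.measure fst") auto

declare step.simps [simp del]

lemma step_1: "step (Suc 0) = \<xi> (Suc 0)"
  by (rule ext) (simp add: step.simps)

lemma step_Suc:
  "n \<ge> 1 \<Longrightarrow> step (Suc n) \<omega> =
     (\<Sum>k=1..n. select n k \<omega> * (repeat n \<omega> * (sign n \<omega> * step k \<omega>))) + (1 - repeat n \<omega>) * \<xi> (Suc n) \<omega>"
  by (subst step.simps) simp

lemma repeat_generated: "repeat n \<in> borel_measurable (generated source {(2, n)})"
proof -
  have [measurable]: "\<gamma> n \<in> borel_measurable (generated source {(2, n)})"
    using measurable_generated[of "(2, n)" "{(2, n)}" source] by simp
  show ?thesis unfolding repeat_def[abs_def] by measurable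
qed

lemma sign_generated: "sign n \<in> borel_measurable (generated source {(3, n)})"
proof -
  have [measurable]: "\<rho> n \<in> borel_measurable (generated source {(3, n)})"
    using measurable_generated[of "(3, n)" "{(3, n)}" source] by simp
  show ?thesis unfolding sign_def[abs_def] by measurable
qed

lemma select_generated: "select n k \<in> borel_measurable (generated source {(1, n)})"
proof -
  have [measurable]: "(\<lambda>\<omega>. real (U n \<omega>)) \<in> borel_measurable (generated source {(1, n)})"
    using measurable_generated[of "(1, n)" "{(1, n)}" source] by simp
  have "select n k = (\<lambda>\<omega>. if real (U n \<omega>) = real k then 1 else 0)"
    by (auto simp: select_def)
  then show ?thesis by (simp only:) measurable
qed

lemma \<xi>_generated: "\<xi> n \<in> borel_measurable (generated source {(0, n)})"
  using measurable_generated[of "(0, n)" "{(0, n)}" source] by simp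

lemma step_past: "1 \<le> k \<Longrightarrow> k \<le> n \<Longrightarrow> step k \<in> borel_measurable (past n)"
proof (induction k arbitrary: n rule: less_induct)
  case (less k)
  show ?case
  proof (cases "k = 1")
    case True
    then show ?thesis
      using less measurable_generated_mono[OF \<xi>_generated[of 1], of "past_indices n"]
      by (auto simp: step_1 past_def past_indices_def)
  next
    case False
    then obtain j where j: "k = Suc j" "1 \<le> j" using less by (cases k) auto
    have [measurable]: "repeat j \<in> borel_measurable (past n)" "sign j \<in> borel_measurable (past n)"
      "select j i \<in> borel_measurable (past n)" "\<xi> (Suc j) \<in> borel_measurable (past n)" for i
      using j less(3) unfolding past_def
      by (auto intro!: measurable_generated_mono[OF repeat_generated] measurable_generated_mono[OF sign_generated]
          measurable_generated_mono[OF select_generated] measurable_generated_mono[OF \<xi>_generated]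
          simp: past_indices_def)
    have [measurable]: "i \<in> {1..j} \<Longrightarrow> step i \<in> borel_measurable (past n)" for i
      using less j by auto
    have "step k = (\<lambda>\<omega>. (\<Sum>i=1..j. select j i \<omega> * (repeat j \<omega> * (sign j \<omega> * step i \<omega>)))
        + (1 - repeat j \<omega>) * \<xi> (Suc j) \<omega>)"
      using j step_Suc by auto
    then show ?thesis by (simp only:) measurable
  qed
qed

lemma source_component_measurable:
  assumes "1 \<le> n"
  shows "\<xi> n \<in> borel_measurable M" "(\<lambda>\<omega>. real (U n \<omega>)) \<in> borel_measurable M"
    "\<gamma> n \<in> borel_measurable M" "\<rho> n \<in> borel_measurable M"
  using source_measurable[of "(0, n)"] source_measurable[of "(1, n)"]
    source_measurable[of "(2, n)"] source_measurable[of "(3, n)"] assms by auto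

lemma AE_U: 
  assumes "1 \<le> n"
  shows "AE \<omega> in M. U n \<omega> \<in> {1..n}"
proof -
  have [measurable]: "U n \<in> measurable M (count_space UNIV)"
    using U_indep assms unfolding indep_vars_def2 by auto
  have "prob {\<omega>\<in>space M. U n \<omega> \<in> {1..n}} = prob (\<Union>k\<in>{1..n}. {\<omega>\<in>space M. U n \<omega> = k})"
    by (rule arg_cong[where f = prob]) auto
  also have "\<dots> = (\<Sum>k=1..n. prob {\<omega>\<in>space M. U n \<omega> = k})"
    by (intro finite_measure_finite_Union) (auto simp: disjoint_family_on_def)
  also have "\<dots> = (\<Sum>k=1..n. 1 / real n)"
    using U_uniform by (intro sum.cong) auto
  also have "\<dots> = 1" using assms by simp
  finally show ?thesis by (subst (asm) prob_Collect_eq_1) auto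
qed

lemma AE_\<gamma>: "1 \<le> n \<Longrightarrow> AE \<omega> in M. \<gamma> n \<omega> = 1 \<or> \<gamma> n \<omega> = 0"
  using \<gamma>_law by (intro AE_two_valued source_component_measurable) auto

lemma AE_\<rho>: "1 \<le> n \<Longrightarrow> AE \<omega> in M. \<rho> n \<omega> = 1 \<or> \<rho> n \<omega> = - 1"
  using \<rho>_law by (intro AE_two_valued source_component_measurable) auto

text \<open>Countably many null sets are discarded at once, and on the rest the recursion determines
  the path. The induction is strong because \<open>U j\<close> may point to any earlier
  step.\<close>

lemma AE_X_eq_step: "AE \<omega> in M. \<forall>n\<ge>1. X n \<omega> = step n \<omega>"
proof -
  have all: "AE \<omega> in M. \<forall>n\<in>{1..}. P n \<omega>" if "\<And>n. 1 \<le> n \<Longrightarrow> AE \<omega> in M. P n \<omega>" for P :: "nat \<Rightarrow> 'a \<Rightarrow> bool"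
    using that by (subst AE_ball_countable) auto
  have U: "AE \<omega> in M. \<forall>n\<in>{1..}. U n \<omega> \<in> {1..n}"
    by (rule all) (rule AE_U)
  have \<gamma>: "AE \<omega> in M. \<forall>n\<in>{1..}. \<gamma> n \<omega> = 1 \<or> \<gamma> n \<omega> = 0"
    by (rule all) (rule AE_\<gamma>)
  have \<rho>: "AE \<omega> in M. \<forall>n\<in>{1..}. \<rho> n \<omega> = 1 \<or> \<rho> n \<omega> = - 1"
    by (rule all) (rule AE_\<rho>)
  have step: "AE \<omega> in M. \<forall>n\<in>{1..}. X (n + 1) \<omega> = \<gamma> n \<omega> * \<rho> n \<omega> * X (U n \<omega>) \<omega> + (1 - \<gamma> n \<omega>) * \<xi> (n + 1) \<omega>"
    by (rule all) (rule X_step)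
  show ?thesis
    using U \<gamma> \<rho> step X_first
  proof eventually_elim
    case (elim \<omega>)
    have "X n \<omega> = step n \<omega>" if "1 \<le> n" for n
      using that
    proof (induction n rule: less_induct)
      case (less n)
      show ?case
      proof (cases "n = 1")
        case True
        then show ?thesis using elim by (simp add: step_1)
      next
        case False
        then obtain j where j: "n = Suc j" "1 \<le> j" using less by (cases n) auto
        have U: "U j \<omega> \<in> {1..j}" using elim j by auto
        then have "X (U j \<omega>) \<omega> = step (U j \<omega>) \<omega>" using less j by auto
        moreover have "X n \<omega> = \<gamma> j \<omega> * \<rho> j \<omega> * X (U j \<omega>) \<omega> + (1 - \<gamma> j \<omega>) * \<xi> n \<omega>"
          using elim j by auto
        moreover have "\<gamma> j \<omega> = repeat j \<omega>" "\<rho> j \<omega> = sign j \<omega>"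
          using elim j by (auto simp: repeat_def sign_def)
        moreover have "step n \<omega> = repeat j \<omega> * (sign j \<omega> * step (U j \<omega>) \<omega>) + (1 - repeat j \<omega>) * \<xi> n \<omega>"
          unfolding j(1) step_Suc[OF j(2)] sum_select using U by simp
        ultimately show ?thesis by (simp add: mult.assoc)
      qed
    qed
    then show ?case by auto
  qed
qed

lemma repeat_moments:
  assumes "1 \<le> n"
  shows "integrable M (repeat n)" "expectation (repeat n) = \<alpha>"
proof -
  note [measurable] = source_component_measurable[OF assms]
  have "{\<omega>\<in>space M. \<gamma> n \<omega> = 1} \<in> events" by measurable
  from prob_indicator[OF this] show "integrable M (repeat n)" "expectation (repeat n) = \<alpha>"
    using \<gamma>_law assms by (auto simp: repeat_def[abs_def])
qed

lemma sign_moments: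
  assumes "1 \<le> n"
  shows "integrable M (sign n)" "expectation (sign n) = 2 * p - 1"
proof -
  note [measurable] = source_component_measurable[OF assms]
  have *: "{\<omega>\<in>space M. \<rho> n \<omega> = 1} \<in> events" by measurable
  have eq: "sign n = (\<lambda>\<omega>. 2 * (if \<rho> n \<omega> = 1 then 1 else 0) - 1)"
    by (auto simp: sign_def)
  show "integrable M (sign n)" "expectation (sign n) = 2 * p - 1"
    using prob_indicator[OF *] \<rho>_law assms unfolding eq by (auto simp: prob_space)
qed

lemma select_moments:
  assumes "k \<in> {1..n}"
  shows "integrable M (select n k)" "expectation (select n k) = 1 / real n"
proof -
  have n: "1 \<le> n" using assms by simp
  note [measurable] = source_component_measurable[OF n]
  have "{\<omega>\<in>space M. real (U n \<omega>) = real k} \<in> events" by measurable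
  then have *: "{\<omega>\<in>space M. U n \<omega> = k} \<in> events" by simp
  show "integrable M (select n k)" "expectation (select n k) = 1 / real n"
    using prob_indicator[OF *] U_uniform[OF assms] by (auto simp: select_def[abs_def])
qed

lemmas expectation_mult_source = expectation_mult_generated[OF indep_source]

end

section \<open>Moments of the walk\<close>

lemma (in prob_space) measurable_generated_mult:
  fixes f g :: "'a \<Rightarrow> real"
  assumes "f \<in> borel_measurable (generated Y A)" "g \<in> borel_measurable (generated Y B)"
  shows "(\<lambda>\<omega>. f \<omega> * g \<omega>) \<in> borel_measurable (generated Y (A \<union> B))"
  using assms by (intro borel_measurable_times) (auto intro: measurable_generated_mono)

locale square_integrable_walk = step_reinforced_walk +
  assumes moment: "integrable M (\<lambda>\<omega>. (\<xi> 1 \<omega>)\<^sup>2)"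
begin

definition a :: real where "a = (2 * p - 1) * \<alpha>"
definition m\<^sub>1 :: real where "m\<^sub>1 = expectation (\<xi> 1)"
definition m\<^sub>2 :: real where "m\<^sub>2 = expectation (\<lambda>\<omega>. (\<xi> 1 \<omega>)\<^sup>2)"

lemma \<xi>_distr:
  fixes h :: "real \<Rightarrow> real"
  assumes n: "1 \<le> n" and h: "h \<in> borel_measurable borel"
  shows "integrable M (\<lambda>\<omega>. h (\<xi> n \<omega>)) \<longleftrightarrow> integrable M (\<lambda>\<omega>. h (\<xi> 1 \<omega>))"
    and "expectation (\<lambda>\<omega>. h (\<xi> n \<omega>)) = expectation (\<lambda>\<omega>. h (\<xi> 1 \<omega>))"
proof -
  have m: "\<xi> n \<in> borel_measurable M" "\<xi> 1 \<in> borel_measurable M"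
    using source_component_measurable n by auto
  show "integrable M (\<lambda>\<omega>. h (\<xi> n \<omega>)) \<longleftrightarrow> integrable M (\<lambda>\<omega>. h (\<xi> 1 \<omega>))"
    using integrable_distr_eq[OF m(1) h] integrable_distr_eq[OF m(2) h] unfolding \<xi>_ident[OF n]
    by (rule trans[OF sym])
  show "expectation (\<lambda>\<omega>. h (\<xi> n \<omega>)) = expectation (\<lambda>\<omega>. h (\<xi> 1 \<omega>))"
    using integral_distr[OF m(1) h] integral_distr[OF m(2) h] unfolding \<xi>_ident[OF n]
    by (rule trans[OF sym])
qed

lemma \<xi>_moments:
  assumes n: "1 \<le> n"
  shows "integrable M (\<lambda>\<omega>. (\<xi> n \<omega>)\<^sup>2)" "expectation (\<lambda>\<omega>. (\<xi> n \<omega>)\<^sup>2) = m\<^sub>2"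
    "integrable M (\<xi> n)" "expectation (\<xi> n) = m\<^sub>1"
proof -
  show 2: "integrable M (\<lambda>\<omega>. (\<xi> n \<omega>)\<^sup>2)" "expectation (\<lambda>\<omega>. (\<xi> n \<omega>)\<^sup>2) = m\<^sub>2"
    using \<xi>_distr[OF n, of "\<lambda>x. x\<^sup>2"] moment by (simp_all add: m\<^sub>2_def)
  show "integrable M (\<xi> n)"
    by (rule square_integrable_imp_integrable[OF source_component_measurable(1)[OF n] 2(1)])
  show "expectation (\<xi> n) = m\<^sub>1"
    using \<xi>_distr(2)[OF n, of "\<lambda>x. x"] by (simp add: m\<^sub>1_def)
qed

lemma repeat_mult:
  assumes n: "1 \<le> n" and "B \<subseteq> source_indices" "(2, n) \<notin> B"
    and Z: "Z \<in> borel_measurable (generated source B)" "integrable M Z"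
  shows "integrable M (\<lambda>\<omega>. repeat n \<omega> * Z \<omega>)" "expectation (\<lambda>\<omega>. repeat n \<omega> * Z \<omega>) = \<alpha> * expectation Z"
proof -
  have I: "{(2, n)} \<inter> B = {}" "{(2, n)} \<subseteq> source_indices"
    using assms by auto
  note * = expectation_mult_source[OF I assms(2) repeat_generated Z(1) repeat_moments(1)[OF n] Z(2)]
  show "integrable M (\<lambda>\<omega>. repeat n \<omega> * Z \<omega>)" by (rule *(1))
  show "expectation (\<lambda>\<omega>. repeat n \<omega> * Z \<omega>) = \<alpha> * expectation Z"
    unfolding *(2) repeat_moments(2)[OF n] by simp
qed

lemma sign_mult:
  assumes n: "1 \<le> n" and "B \<subseteq> source_indices" "(3, n) \<notin> B"
    and Z: "Z \<in> borel_measurable (generated source B)" "integrable M Z"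
  shows "integrable M (\<lambda>\<omega>. sign n \<omega> * Z \<omega>)" "expectation (\<lambda>\<omega>. sign n \<omega> * Z \<omega>) = (2 * p - 1) * expectation Z"
proof -
  have I: "{(3, n)} \<inter> B = {}" "{(3, n)} \<subseteq> source_indices"
    using assms by auto
  note * = expectation_mult_source[OF I assms(2) sign_generated Z(1) sign_moments(1)[OF n] Z(2)]
  show "integrable M (\<lambda>\<omega>. sign n \<omega> * Z \<omega>)" by (rule *(1))
  show "expectation (\<lambda>\<omega>. sign n \<omega> * Z \<omega>) = (2 * p - 1) * expectation Z"
    unfolding *(2) sign_moments(2)[OF n] by simp
qed

lemma select_mult:
  assumes k: "k \<in> {1..n}" and "B \<subseteq> source_indices" "(1, n) \<notin> B"
    and Z: "Z \<in> borel_measurable (generated source B)" "integrable M Z"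
  shows "integrable M (\<lambda>\<omega>. select n k \<omega> * Z \<omega>)" "expectation (\<lambda>\<omega>. select n k \<omega> * Z \<omega>) = expectation Z / real n"
proof -
  have I: "{(1, n)} \<inter> B = {}" "{(1, n)} \<subseteq> source_indices"
    using assms by auto
  note * = expectation_mult_source[OF I assms(2) select_generated Z(1) select_moments(1)[OF k] Z(2)]
  show "integrable M (\<lambda>\<omega>. select n k \<omega> * Z \<omega>)" by (rule *(1))
  show "expectation (\<lambda>\<omega>. select n k \<omega> * Z \<omega>) = expectation Z / real n"
    unfolding *(2) select_moments(2)[OF k] by simp
qed

lemma past_disjoint: "(1, n) \<notin> past_indices n" "(2, n) \<notin> past_indices n" "(3, n) \<notin> past_indices n"
    "(0, Suc n) \<notin> past_indices n"
  by (auto simp: past_indices_def)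

text \<open>The unsigned case, meant for squared steps: here the weight of an earlier step is
  \<alpha> / n rather than a / n.\<close>

lemma select_repeat_mult:
  assumes k: "k \<in> {1..n}" and Z: "Z \<in> borel_measurable (past n)" "integrable M Z"
  shows "integrable M (\<lambda>\<omega>. select n k \<omega> * (repeat n \<omega> * Z \<omega>))"
    and "expectation (\<lambda>\<omega>. select n k \<omega> * (repeat n \<omega> * Z \<omega>)) = \<alpha> / real n * expectation Z"
proof -
  have n: "1 \<le> n" using k by simp
  note Zg = Z(1)[unfolded past_def]
  note 1 = repeat_mult[OF n past_indices_subset past_disjoint(2) Zg Z(2)]
  note m = measurable_generated_mult[OF repeat_generated Zg]
  have B: "{(2, n)} \<union> past_indices n \<subseteq> source_indices" "(1, n) \<notin> {(2, n)} \<union> past_indices n"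
    using n past_indices_subset past_disjoint by auto
  show "integrable M (\<lambda>\<omega>. select n k \<omega> * (repeat n \<omega> * Z \<omega>))"
    "expectation (\<lambda>\<omega>. select n k \<omega> * (repeat n \<omega> * Z \<omega>)) = \<alpha> / real n * expectation Z"
    using select_mult[OF k B m 1(1)] 1(2) by simp_all
qed

text \<open>The fresh factors are split off one at a time, the index set of the remaining product
  growing accordingly. They contribute \<open>2 * p - 1\<close>, \<open>\<alpha>\<close> and
  \<open>1 / n\<close>, whose product is \<open>a / n\<close>.\<close>

lemma select_repeat_sign_mult:
  assumes k: "k \<in> {1..n}" and Z: "Z \<in> borel_measurable (past n)" "integrable M Z"
  shows "integrable M (\<lambda>\<omega>. select n k \<omega> * (repeat n \<omega> * (sign n \<omega> * Z \<omega>)))"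
    and "expectation (\<lambda>\<omega>. select n k \<omega> * (repeat n \<omega> * (sign n \<omega> * Z \<omega>))) = a / real n * expectation Z"
proof -
  have n: "1 \<le> n" using k by simp
  note Zg = Z(1)[unfolded past_def]
  note 1 = sign_mult[OF n past_indices_subset past_disjoint(3) Zg Z(2)]
  note m1 = measurable_generated_mult[OF sign_generated Zg]
  have B1: "{(3, n)} \<union> past_indices n \<subseteq> source_indices" "(2, n) \<notin> {(3, n)} \<union> past_indices n"
    using n past_indices_subset past_disjoint by auto
  note 2 = repeat_mult[OF n B1 m1 1(1)]
  note m2 = measurable_generated_mult[OF repeat_generated m1]
  have B2: "{(2, n)} \<union> ({(3, n)} \<union> past_indices n) \<subseteq> source_indices"
    "(1, n) \<notin> {(2, n)} \<union> ({(3, n)} \<union> past_indices n)"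
    using n past_indices_subset past_disjoint by auto
  show "integrable M (\<lambda>\<omega>. select n k \<omega> * (repeat n \<omega> * (sign n \<omega> * Z \<omega>)))"
    "expectation (\<lambda>\<omega>. select n k \<omega> * (repeat n \<omega> * (sign n \<omega> * Z \<omega>))) = a / real n * expectation Z"
    using select_mult[OF k B2 m2 2(1)] 2(2) 1(2) by (simp_all add: a_def)
qed

lemma fresh_mult:
  assumes n: "1 \<le> n" and Z: "Z \<in> borel_measurable (past n)" "integrable M Z"
    and h: "h \<in> borel_measurable borel" "integrable M (\<lambda>\<omega>. h (\<xi> (Suc n) \<omega>))"
  shows "integrable M (\<lambda>\<omega>. (1 - repeat n \<omega>) * (h (\<xi> (Suc n) \<omega>) * Z \<omega>))"
    and "expectation (\<lambda>\<omega>. (1 - repeat n \<omega>) * (h (\<xi> (Suc n) \<omega>) * Z \<omega>))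
      = (1 - \<alpha>) * (expectation (\<lambda>\<omega>. h (\<xi> (Suc n) \<omega>)) * expectation Z)"
proof -
  note Zg = Z(1)[unfolded past_def]
  have hg: "(\<lambda>\<omega>. h (\<xi> (Suc n) \<omega>)) \<in> borel_measurable (generated source {(0, Suc n)})"
    using measurable_compose[OF \<xi>_generated h(1)] .
  have 1: "integrable M (\<lambda>\<omega>. h (\<xi> (Suc n) \<omega>) * Z \<omega>)"
    "expectation (\<lambda>\<omega>. h (\<xi> (Suc n) \<omega>) * Z \<omega>) = expectation (\<lambda>\<omega>. h (\<xi> (Suc n) \<omega>)) * expectation Z"
    using expectation_mult_source[OF _ _ past_indices_subset hg Zg h(2) Z(2)] past_disjoint by auto
  note m = measurable_generated_mult[OF hg Zg]
  have B: "{(0, Suc n)} \<union> past_indices n \<subseteq> source_indices" "(2, n) \<notin> {(0, Suc n)} \<union> past_indices n"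
    using past_indices_subset past_disjoint by auto
  note 2 = repeat_mult[OF n B m 1(1)]
  show "integrable M (\<lambda>\<omega>. (1 - repeat n \<omega>) * (h (\<xi> (Suc n) \<omega>) * Z \<omega>))"
    "expectation (\<lambda>\<omega>. (1 - repeat n \<omega>) * (h (\<xi> (Suc n) \<omega>) * Z \<omega>))
      = (1 - \<alpha>) * (expectation (\<lambda>\<omega>. h (\<xi> (Suc n) \<omega>)) * expectation Z)"
    using 1 2 by (simp_all add: left_diff_distrib)
qed

text \<open>Since \<open>repeat n\<close> is 0 or 1 the mixed term vanishes, and
  \<open>sign n\<close> squares to 1. The trailing factor 1 gives the last term the shape of
  \<open>fresh_mult\<close> with \<open>Z = 1\<close>.\<close>

lemma step_square:
  assumes "1 \<le> n"
  shows "(step (Suc n) \<omega>)\<^sup>2 =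
    (\<Sum>k=1..n. select n k \<omega> * (repeat n \<omega> * (step k \<omega>)\<^sup>2)) + (1 - repeat n \<omega>) * ((\<xi> (Suc n) \<omega>)\<^sup>2 * 1)"
  unfolding step_Suc[OF assms] sum_select
  by (auto simp: repeat_def sign_def)

lemma past_measurable: "f \<in> borel_measurable (past n) \<Longrightarrow> f \<in> borel_measurable M"
  using measurable_from_subalg[OF subalgebra_past] .

lemma step_measurable [measurable]: "step n \<in> borel_measurable M" if "1 \<le> n"
  using past_measurable[OF step_past[OF that order_refl]] .

text \<open>A squared step averages the earlier squares with weight \<alpha> and a fresh square with
  weight 1 - \<alpha>, so the value \<open>m\<^sub>2\<close> reproduces itself, whatever
  \<open>p\<close> is.\<close>

lemma step_moments:
  assumes "1 \<le> n"
  shows "integrable M (\<lambda>\<omega>. (step n \<omega>)\<^sup>2)" "expectation (\<lambda>\<omega>. (step n \<omega>)\<^sup>2) = m\<^sub>2"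
proof -
  have "integrable M (\<lambda>\<omega>. (step n \<omega>)\<^sup>2) \<and> expectation (\<lambda>\<omega>. (step n \<omega>)\<^sup>2) = m\<^sub>2"
    using assms
  proof (induction n rule: less_induct)
    case (less n)
    show ?case
    proof (cases "n = 1")
      case True
      then show ?thesis using \<xi>_moments[of 1] by (simp add: step_1)
    next
      case False
      then obtain j where j: "n = Suc j" "1 \<le> j" using less by (cases n) auto
      have past: "(\<lambda>\<omega>. (step k \<omega>)\<^sup>2) \<in> borel_measurable (past j)" if "k \<in> {1..j}" for k
        using step_past[of k j] that by auto
      have IH: "integrable M (\<lambda>\<omega>. (step k \<omega>)\<^sup>2)" "expectation (\<lambda>\<omega>. (step k \<omega>)\<^sup>2) = m\<^sub>2" if "k \<in> {1..j}" for k
        using less that j by auto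
      note sr = select_repeat_mult[OF _ past IH(1)]
      have one: "(\<lambda>_. 1 :: real) \<in> borel_measurable (past j)" "integrable M (\<lambda>_. 1 :: real)"
        by auto
      have square: "(\<lambda>x. x\<^sup>2 :: real) \<in> borel_measurable borel"
        by measurable
      have \<xi>2: "integrable M (\<lambda>\<omega>. (\<xi> (Suc j) \<omega>)\<^sup>2)" "expectation (\<lambda>\<omega>. (\<xi> (Suc j) \<omega>)\<^sup>2) = m\<^sub>2"
        by (rule \<xi>_moments, simp)+
      have fr: "integrable M (\<lambda>\<omega>. (1 - repeat j \<omega>) * ((\<xi> (Suc j) \<omega>)\<^sup>2 * 1))"
        "expectation (\<lambda>\<omega>. (1 - repeat j \<omega>) * ((\<xi> (Suc j) \<omega>)\<^sup>2 * 1)) = (1 - \<alpha>) * (m\<^sub>2 * expectation (\<lambda>_. 1))"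
        using fresh_mult[OF j(2) one square \<xi>2(1)] unfolding \<xi>2(2) .
      have "integrable M (\<lambda>\<omega>. (step n \<omega>)\<^sup>2)"
        unfolding j(1) step_square[OF j(2)] using sr(1) fr(1)
        by (intro Bochner_Integration.integrable_add Bochner_Integration.integrable_sum) auto
      moreover have "expectation (\<lambda>\<omega>. (step n \<omega>)\<^sup>2) = (\<Sum>k=1..j. \<alpha> / real j * m\<^sub>2) + (1 - \<alpha>) * m\<^sub>2"
      proof -
        have "expectation (\<lambda>\<omega>. (step n \<omega>)\<^sup>2) =
            expectation (\<lambda>\<omega>. \<Sum>k=1..j. select j k \<omega> * (repeat j \<omega> * (step k \<omega>)\<^sup>2)) + (1 - \<alpha>) * (m\<^sub>2 * expectation (\<lambda>_. 1))"
          unfolding j(1) step_square[OF j(2)] fr(2)[symmetric] using sr(1) fr(1)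
          by (intro Bochner_Integration.integral_add Bochner_Integration.integrable_sum) auto
        also have "expectation (\<lambda>\<omega>. \<Sum>k=1..j. select j k \<omega> * (repeat j \<omega> * (step k \<omega>)\<^sup>2)) =
            (\<Sum>k=1..j. expectation (\<lambda>\<omega>. select j k \<omega> * (repeat j \<omega> * (step k \<omega>)\<^sup>2)))"
          by (rule Bochner_Integration.integral_sum) (rule sr(1))
        also have "\<dots> = (\<Sum>k=1..j. \<alpha> / real j * m\<^sub>2)"
          by (intro sum.cong refl) (simp only: sr(2) IH(2))
        finally show ?thesis by (simp add: prob_space)
      qed
      moreover have "\<dots> = m\<^sub>2" using j(2) by (simp add: algebra_simps)
      ultimately show ?thesis by simp
    qed
  qed
  then show "integrable M (\<lambda>\<omega>. (step n \<omega>)\<^sup>2)" "expectation (\<lambda>\<omega>. (step n \<omega>)\<^sup>2) = m\<^sub>2" by auto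
qed

section \<open>Innovations and the centred walk\<close>

definition position :: "nat \<Rightarrow> 'a \<Rightarrow> real" where
  "position n \<omega> = (\<Sum>k=1..n. step k \<omega>)"

text \<open>The step minus its conditional mean given the past; this reading starts at
  \<open>n = 2\<close>. At \<open>n = 1\<close> the division by 0 yields 0, and the martingale below
  uses \<open>deviation 1\<close> as its first term instead.\<close>

definition innovation :: "nat \<Rightarrow> 'a \<Rightarrow> real" where
  "innovation n \<omega> = step n \<omega> - (a / real (n - 1) * position (n - 1) \<omega> + (1 - \<alpha>) * m\<^sub>1)"

lemma position_past: "n \<le> m \<Longrightarrow> position n \<in> borel_measurable (past m)"
  unfolding position_def[abs_def] by (intro borel_measurable_sum step_past) auto

lemma position_measurable [measurable]: "position n \<in> borel_measurable M"
  using past_measurable[OF position_past[OF order_refl]] .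

lemma position_square_integrable: "integrable M (\<lambda>\<omega>. (position n \<omega>)\<^sup>2)"
  unfolding position_def by (intro integrable_square_sum step_moments step_measurable) auto

lemma innovation_past: "1 \<le> n \<Longrightarrow> innovation n \<in> borel_measurable (past n)"
  unfolding innovation_def[abs_def]
  by (intro borel_measurable_diff borel_measurable_add borel_measurable_times borel_measurable_const
      step_past position_past) auto

text \<open>The conditional mean of the next step in weak form, tested against the square-integrable
  functions \<open>Z\<close> of the past.\<close>

lemma expectation_mult_step:
  assumes n: "1 \<le> n" and Z: "Z \<in> borel_measurable (past n)" "integrable M (\<lambda>\<omega>. (Z \<omega>)\<^sup>2)"
  shows "expectation (\<lambda>\<omega>. Z \<omega> * step (Suc n) \<omega>) =
      expectation (\<lambda>\<omega>. Z \<omega> * (a / real n * position n \<omega> + (1 - \<alpha>) * m\<^sub>1))"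
proof -
  have [measurable]: "Z \<in> borel_measurable M" using Z(1) by (rule past_measurable)
  have Zi: "integrable M Z" by (rule square_integrable_imp_integrable[OF _ Z(2)]) measurable
  have past: "(\<lambda>\<omega>. Z \<omega> * step k \<omega>) \<in> borel_measurable (past n)" if "k \<in> {1..n}" for k
    using that Z(1) by (intro borel_measurable_times step_past) auto
  have int: "integrable M (\<lambda>\<omega>. Z \<omega> * step k \<omega>)" if "k \<in> {1..n}" for k
    using that by (intro integrable_mult_of_squares Z step_moments) auto
  note s = select_repeat_sign_mult[OF _ past int]
  have id: "(\<lambda>x. x :: real) \<in> borel_measurable borel"
    by measurable
  have \<xi>1: "integrable M (\<lambda>\<omega>. \<xi> (Suc n) \<omega>)" "expectation (\<lambda>\<omega>. \<xi> (Suc n) \<omega>) = m\<^sub>1"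
    by (rule \<xi>_moments, simp)+
  have fr: "integrable M (\<lambda>\<omega>. (1 - repeat n \<omega>) * (\<xi> (Suc n) \<omega> * Z \<omega>))"
    "expectation (\<lambda>\<omega>. (1 - repeat n \<omega>) * (\<xi> (Suc n) \<omega> * Z \<omega>)) = (1 - \<alpha>) * (m\<^sub>1 * expectation Z)"
    using fresh_mult[OF n Z(1) Zi id \<xi>1(1)] unfolding \<xi>1(2) .
  have eq: "Z \<omega> * step (Suc n) \<omega> =
    (\<Sum>k=1..n. select n k \<omega> * (repeat n \<omega> * (sign n \<omega> * (Z \<omega> * step k \<omega>)))) + (1 - repeat n \<omega>) * (\<xi> (Suc n) \<omega> * Z \<omega>)" for \<omega>
    unfolding step_Suc[OF n] by (simp add: distrib_left sum_distrib_left mult_ac)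
  have "expectation (\<lambda>\<omega>. Z \<omega> * step (Suc n) \<omega>) =
      expectation (\<lambda>\<omega>. \<Sum>k=1..n. select n k \<omega> * (repeat n \<omega> * (sign n \<omega> * (Z \<omega> * step k \<omega>)))) + (1 - \<alpha>) * (m\<^sub>1 * expectation Z)"
    unfolding eq fr(2)[symmetric] using s(1) fr(1)
    by (intro Bochner_Integration.integral_add Bochner_Integration.integrable_sum) auto
  also have "expectation (\<lambda>\<omega>. \<Sum>k=1..n. select n k \<omega> * (repeat n \<omega> * (sign n \<omega> * (Z \<omega> * step k \<omega>)))) =
      (\<Sum>k=1..n. expectation (\<lambda>\<omega>. select n k \<omega> * (repeat n \<omega> * (sign n \<omega> * (Z \<omega> * step k \<omega>)))))"
    by (rule Bochner_Integration.integral_sum) (rule s(1))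
  also have "\<dots> = (\<Sum>k=1..n. a / real n * expectation (\<lambda>\<omega>. Z \<omega> * step k \<omega>))"
    by (intro sum.cong refl) (rule s(2))
  also have "(\<Sum>k=1..n. a / real n * expectation (\<lambda>\<omega>. Z \<omega> * step k \<omega>)) =
      a / real n * expectation (\<lambda>\<omega>. Z \<omega> * position n \<omega>)"
    unfolding position_def using int by (simp add: sum_distrib_left)
  also have "\<dots> + (1 - \<alpha>) * (m\<^sub>1 * expectation Z) =
      expectation (\<lambda>\<omega>. a / real n * (Z \<omega> * position n \<omega>) + (1 - \<alpha>) * m\<^sub>1 * Z \<omega>)"
    using Zi integrable_mult_of_squares[OF _ _ Z(2) position_square_integrable, of n] by simp
  also have "\<dots> = expectation (\<lambda>\<omega>. Z \<omega> * (a / real n * position n \<omega> + (1 - \<alpha>) * m\<^sub>1))"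
    by (simp add: algebra_simps)
  finally show ?thesis .
qed

lemma predictor_square_integrable: "integrable M (\<lambda>\<omega>. (c * position n \<omega> + d)\<^sup>2)"
  by (intro integrable_square_add) (auto simp: power_mult_distrib intro: position_square_integrable)

lemma innovation_measurable: "1 \<le> n \<Longrightarrow> innovation n \<in> borel_measurable M"
  using past_measurable[OF innovation_past] .

lemma innovation_square_integrable:
  assumes "1 \<le> n"
  shows "integrable M (\<lambda>\<omega>. (innovation n \<omega>)\<^sup>2)"
proof -
  have "integrable M (\<lambda>\<omega>. (step n \<omega> + ((- (a / real (n - 1))) * position (n - 1) \<omega> + - ((1 - \<alpha>) * m\<^sub>1)))\<^sup>2)"
    using assms by (intro integrable_square_add step_moments predictor_square_integrable) auto
  then show ?thesis by (simp add: innovation_def algebra_simps)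
qed

lemma innovation_orthogonal:
  assumes n: "1 \<le> n" and Z: "Z \<in> borel_measurable (past n)" "integrable M (\<lambda>\<omega>. (Z \<omega>)\<^sup>2)"
  shows "expectation (\<lambda>\<omega>. Z \<omega> * innovation (Suc n) \<omega>) = 0"
proof -
  have [measurable]: "Z \<in> borel_measurable M" using Z(1) by (rule past_measurable)
  have [measurable]: "step (Suc n) \<in> borel_measurable M" by simp
  have "expectation (\<lambda>\<omega>. Z \<omega> * innovation (Suc n) \<omega>) = expectation (\<lambda>\<omega>. Z \<omega> * step (Suc n) \<omega>
      - Z \<omega> * (a / real n * position n \<omega> + (1 - \<alpha>) * m\<^sub>1))"
    by (simp add: innovation_def right_diff_distrib)
  also have "\<dots> = expectation (\<lambda>\<omega>. Z \<omega> * step (Suc n) \<omega>) -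
      expectation (\<lambda>\<omega>. Z \<omega> * (a / real n * position n \<omega> + (1 - \<alpha>) * m\<^sub>1))"
    by (intro Bochner_Integration.integral_diff integrable_mult_of_squares Z step_moments
        predictor_square_integrable) auto
  finally show ?thesis using expectation_mult_step[OF assms] by simp
qed

text \<open>Pythagoras: the step is the sum of its innovation and its predictor, which are
  orthogonal because the predictor belongs to the past.\<close>

lemma innovation_second_moment:
  assumes n: "1 \<le> n"
  shows "expectation (\<lambda>\<omega>. (innovation (Suc n) \<omega>)\<^sup>2) =
      m\<^sub>2 - expectation (\<lambda>\<omega>. (a / real n * position n \<omega> + (1 - \<alpha>) * m\<^sub>1)\<^sup>2)"
proof -
  define Q where "Q \<omega> = a / real n * position n \<omega> + (1 - \<alpha>) * m\<^sub>1" for \<omega>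
  have Q: "Q \<in> borel_measurable (past n)" "integrable M (\<lambda>\<omega>. (Q \<omega>)\<^sup>2)"
    unfolding Q_def[abs_def] using position_past[of n n]
    by (auto intro: predictor_square_integrable simp del: times_divide_eq_left)
  have [measurable]: "Q \<in> borel_measurable M" "innovation (Suc n) \<in> borel_measurable M"
    using Q(1) past_measurable innovation_measurable by auto
  note I = innovation_square_integrable[of "Suc n"]
  have IQ: "integrable M (\<lambda>\<omega>. Q \<omega> * innovation (Suc n) \<omega>)"
    using I Q by (intro integrable_mult_of_squares) auto
  have "m\<^sub>2 = expectation (\<lambda>\<omega>. (step (Suc n) \<omega>)\<^sup>2)"
    using step_moments[of "Suc n"] by simp
  also have "\<dots> = expectation (\<lambda>\<omega>. (innovation (Suc n) \<omega>)\<^sup>2 + (Q \<omega>)\<^sup>2 + 2 * (Q \<omega> * innovation (Suc n) \<omega>))"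
    by (intro Bochner_Integration.integral_cong) (auto simp: innovation_def Q_def power2_eq_square algebra_simps)
  also have "\<dots> = expectation (\<lambda>\<omega>. (innovation (Suc n) \<omega>)\<^sup>2) + expectation (\<lambda>\<omega>. (Q \<omega>)\<^sup>2)"
    using I Q IQ innovation_orthogonal[OF n Q] by simp
  finally show ?thesis by (simp add: Q_def)
qed

lemma innovation_second_moment_le: "1 \<le> n \<Longrightarrow> expectation (\<lambda>\<omega>. (innovation (Suc n) \<omega>)\<^sup>2) \<le> m\<^sub>2"
  using innovation_second_moment by simp

definition centre :: real where "centre = (1 - \<alpha>) * m\<^sub>1 / (1 - a)"

definition deviation :: "nat \<Rightarrow> 'a \<Rightarrow> real" where
  "deviation n \<omega> = position n \<omega> - real n * centre"

lemma deviation_past: "n \<le> m \<Longrightarrow> deviation n \<in> borel_measurable (past m)"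
  unfolding deviation_def[abs_def] using position_past by simp

lemma deviation_measurable [measurable]: "deviation n \<in> borel_measurable M"
  using past_measurable[OF deviation_past[OF order_refl]] .

lemma deviation_square_integrable: "integrable M (\<lambda>\<omega>. (deviation n \<omega>)\<^sup>2)"
  using predictor_square_integrable[of 1 n "- (real n * centre)"] by (simp add: deviation_def)

lemma predictor_eq:
  assumes "a < 1" "1 \<le> n"
  shows "a / real n * position n \<omega> + (1 - \<alpha>) * m\<^sub>1 = a / real n * deviation n \<omega> + centre"
proof -
  have "centre = a * centre + (1 - \<alpha>) * m\<^sub>1"
    using assms(1) by (simp add: centre_def field_simps)
  moreover have "a / real n * (position n \<omega> - real n * centre) = a / real n * position n \<omega> - a * centre"
    using assms(2) by (simp add: right_diff_distrib)
  ultimately show ?thesis by (simp only: deviation_def)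
qed

lemma deviation_Suc:
  assumes "a < 1" "1 \<le> n"
  shows "deviation (Suc n) \<omega> = (1 + a / real n) * deviation n \<omega> + innovation (Suc n) \<omega>"
proof -
  have "innovation (Suc n) \<omega> = step (Suc n) \<omega> - (a / real n * deviation n \<omega> + centre)"
    using predictor_eq[OF assms, of \<omega>] by (simp add: innovation_def)
  moreover have "deviation (Suc n) \<omega> = deviation n \<omega> + step (Suc n) \<omega> - centre"
    by (simp add: deviation_def position_def distrib_right)
  ultimately show ?thesis by (simp add: distrib_right)
qed

text \<open>Index \<open>n\<close> stands for time \<open>n + 1\<close>, as the walk starts at time
  1. The weights are arbitrary, zeros included: the logarithmic ones vanish at 1, where the quotient
  is then 0.\<close>

lemma martingale_innovations:
  "martingale_differences M (\<lambda>n. past (Suc n))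
     (\<lambda>n \<omega>. (if n = 0 then deviation 1 \<omega> else innovation (Suc n) \<omega>) / c (Suc n))"
proof
  show "subalgebra M (past (Suc n))" for n by (rule subalgebra_past)
  show "m \<le> n \<Longrightarrow> subalgebra (past (Suc n)) (past (Suc m))" for m n by (rule past_mono) simp
  show "(\<lambda>\<omega>. (if n = 0 then deviation 1 \<omega> else innovation (Suc n) \<omega>) / c (Suc n)) \<in> borel_measurable (past (Suc n))" for n
    using deviation_past[of 1 1] innovation_past[of "Suc n"] by (cases "n = 0") auto
  show "integrable M (\<lambda>\<omega>. ((if n = 0 then deviation 1 \<omega> else innovation (Suc n) \<omega>) / c (Suc n))\<^sup>2)" for n
    using deviation_square_integrable innovation_square_integrable by (cases "n = 0") (auto simp: power_divide)
  show "expectation (\<lambda>\<omega>. Z \<omega> * ((if Suc n = 0 then deviation 1 \<omega> else innovation (Suc (Suc n)) \<omega>) / c (Suc (Suc n)))) = 0"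
    if "Z \<in> borel_measurable (past (Suc n))" "integrable M (\<lambda>\<omega>. (Z \<omega>)\<^sup>2)" for n Z
    using innovation_orthogonal[OF _ that] by simp
qed

lemma summable_innovation_moments:
  assumes "summable (\<lambda>n. 1 / (c n)\<^sup>2)"
  shows "summable (\<lambda>n. expectation (\<lambda>\<omega>. ((if n = 0 then deviation 1 \<omega> else innovation (Suc n) \<omega>) / c (Suc n))\<^sup>2))"
proof (rule summable_comparison_test_ev)
  show "summable (\<lambda>n. m\<^sub>2 * (1 / (c (Suc n))\<^sup>2))"
    using assms by (intro summable_mult) (subst summable_Suc_iff)
  show "eventually (\<lambda>n. norm (expectation (\<lambda>\<omega>. ((if n = 0 then deviation 1 \<omega> else innovation (Suc n) \<omega>) / c (Suc n))\<^sup>2))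
      \<le> m\<^sub>2 * (1 / (c (Suc n))\<^sup>2)) sequentially"
    \<comment> \<open>The term at 0 contains \<open>deviation 1\<close>, to which the bound by
      \<open>m\<^sub>2\<close> does not apply.\<close>
    using eventually_ge_at_top[of 1]
  proof eventually_elim
    case (elim n)
    then have "expectation (\<lambda>\<omega>. ((if n = 0 then deviation 1 \<omega> else innovation (Suc n) \<omega>) / c (Suc n))\<^sup>2)
        = expectation (\<lambda>\<omega>. (innovation (Suc n) \<omega>)\<^sup>2) / (c (Suc n))\<^sup>2"
      by (simp add: power_divide)
    also have "\<dots> \<le> m\<^sub>2 / (c (Suc n))\<^sup>2"
      using innovation_second_moment_le[OF elim] by (intro divide_right_mono) auto
    finally show ?case by simp
  qed
qed

lemma AE_summable_innovations:
  assumes c: "summable (\<lambda>n. 1 / (c n)\<^sup>2)"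
  shows "AE \<omega> in M. summable (\<lambda>n. innovation n \<omega> / c n)"
proof -
  interpret D: martingale_differences M "\<lambda>n. past (Suc n)"
     "\<lambda>n \<omega>. (if n = 0 then deviation 1 \<omega> else innovation (Suc n) \<omega>) / c (Suc n)"
    by (rule martingale_innovations)
  from D.AE_convergent[OF summable_innovation_moments[OF c]] show ?thesis
  proof eventually_elim
    case (elim \<omega>)
    then have "summable (\<lambda>n. (if n = 0 then deviation 1 \<omega> else innovation (Suc n) \<omega>) / c (Suc n))"
      unfolding D.S_def by (simp add: summable_iff_convergent')
    moreover have "eventually (\<lambda>n. (if n = 0 then deviation 1 \<omega> else innovation (Suc n) \<omega>) / c (Suc n)
        = innovation (Suc n) \<omega> / c (Suc n)) sequentially"
      by (rule eventually_sequentiallyI[of 1]) auto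
    ultimately have "summable (\<lambda>n. innovation (Suc n) \<omega> / c (Suc n))"
      by (simp only: summable_cong)
    then show ?case by (simp add: summable_Suc_iff[of "\<lambda>n. innovation n \<omega> / c n"])
  qed
qed

section \<open>Limits\<close>

lemma deviation_div:
  "1 \<le> n \<Longrightarrow> deviation n \<omega> / real n = position n \<omega> / real n - (1 - \<alpha>) * m\<^sub>1 / (1 - a)"
  by (simp add: deviation_def centre_def diff_divide_distrib)

lemma normalised_position_eq:
  assumes "1 \<le> n"
  shows "sqrt (real n) / v * (position n \<omega> / real n - (1 - \<alpha>) * m\<^sub>1 / (1 - a)) = deviation n \<omega> / (sqrt (real n) * v)"
proof -
  define r where "r = sqrt (real n)"
  have r: "real n = r * r" "r \<noteq> 0" using assms by (auto simp: r_def)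
  have "sqrt (real n) / v * (deviation n \<omega> / real n) = deviation n \<omega> / (sqrt (real n) * v)"
    unfolding r_def[symmetric] unfolding r(1) using r(2) by simp
  then show ?thesis unfolding deviation_div[OF assms] .
qed

lemma diffusive_limit:
  assumes "- 1 \<le> a" "a < 1 / 2" "0 < \<delta>"
  shows "AE \<omega> in M. (\<lambda>n. sqrt (real n) / (ln (real n) powr (1 / 2 + \<delta>)) *
      (position n \<omega> / real n - (1 - \<alpha>) * m\<^sub>1 / (1 - a))) \<longlonglongrightarrow> 0"
  using AE_summable_innovations[OF summable_inverse_log_weight[OF assms(3)]]
proof eventually_elim
  case (elim \<omega>)
  have "(\<lambda>n. deviation n \<omega> / (sqrt (real n) * ln (real n) powr (1 / 2 + \<delta>))) \<longlonglongrightarrow> 0"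
    by (rule log_normalised_tendsto_0[OF deviation_Suc assms elim]) (use assms in auto)
  then show ?case
    by (rule Lim_transform_eventually)
       (rule eventually_sequentiallyI[of 1], rule normalised_position_eq[symmetric])
qed

lemma critical_limit:
  assumes "a = 1 / 2" "0 < \<delta>"
  shows "AE \<omega> in M. (\<lambda>n. sqrt (real n) / (sqrt (ln (real n)) * ln (ln (real n)) powr (1 / 2 + \<delta>)) *
      (position n \<omega> / real n - (1 - \<alpha>) * m\<^sub>1 / (1 - a))) \<longlonglongrightarrow> 0"
  using AE_summable_innovations[OF summable_inverse_loglog_weight[OF assms(2)]]
proof eventually_elim
  case (elim \<omega>)
  have rec: "deviation (Suc n) \<omega> = (1 + (1 / 2) / real n) * deviation n \<omega> + innovation (Suc n) \<omega>" if "1 \<le> n" for n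
    using deviation_Suc[OF _ that, of \<omega>] assms(1) by simp
  have "(\<lambda>n. deviation n \<omega> / (sqrt (real n) * (sqrt (ln (real n)) * ln (ln (real n)) powr (1 / 2 + \<delta>)))) \<longlonglongrightarrow> 0"
    by (rule loglog_normalised_tendsto_0[OF rec assms(2) elim])
  then show ?case
    by (rule Lim_transform_eventually)
       (rule eventually_sequentiallyI[of 1], rule normalised_position_eq[symmetric])
qed

lemma deviation_1: "deviation 1 \<omega> = \<xi> 1 \<omega> - centre"
  by (simp add: deviation_def position_def step_1)

lemma deviation_integrable: "integrable M (deviation n)"
  by (rule square_integrable_imp_integrable[OF deviation_measurable deviation_square_integrable])

lemma innovation_mean:
  assumes "1 \<le> n"
  shows "integrable M (innovation (Suc n))" "expectation (innovation (Suc n)) = 0"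
proof -
  show "integrable M (innovation (Suc n))"
    by (rule square_integrable_imp_integrable[OF innovation_measurable innovation_square_integrable]) auto
  show "expectation (innovation (Suc n)) = 0"
    using innovation_orthogonal[OF assms, of "\<lambda>_. 1"] by simp
qed

lemma deviation_first_moments:
  "expectation (deviation 1) = m\<^sub>1 - centre"
  "expectation (\<lambda>\<omega>. (deviation 1 \<omega>)\<^sup>2) = m\<^sub>2 - 2 * centre * m\<^sub>1 + centre\<^sup>2"
proof -
  note \<xi> = \<xi>_moments[OF order_refl]
  show "expectation (deviation 1) = m\<^sub>1 - centre"
    unfolding deviation_1[abs_def] using \<xi>(3,4) by (simp add: prob_space)
  have "(deviation 1 \<omega>)\<^sup>2 = (\<xi> 1 \<omega>)\<^sup>2 - 2 * centre * \<xi> 1 \<omega> + centre\<^sup>2" for \<omega>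
    by (simp only: deviation_1 power2_diff) (simp add: mult_ac)
  then show "expectation (\<lambda>\<omega>. (deviation 1 \<omega>)\<^sup>2) = m\<^sub>2 - 2 * centre * m\<^sub>1 + centre\<^sup>2"
    using \<xi> by (simp add: prob_space)
qed

lemma deviation_second_moment_Suc:
  assumes "a < 1" "1 \<le> n"
  shows "expectation (\<lambda>\<omega>. (deviation (Suc n) \<omega>)\<^sup>2) =
      (1 + a / real n)\<^sup>2 * expectation (\<lambda>\<omega>. (deviation n \<omega>)\<^sup>2) + expectation (\<lambda>\<omega>. (innovation (Suc n) \<omega>)\<^sup>2)"
proof -
  note d2 = deviation_square_integrable[of n]
  note i2 = innovation_square_integrable[of "Suc n", simplified]
  have di: "integrable M (\<lambda>\<omega>. deviation n \<omega> * innovation (Suc n) \<omega>)"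
    using d2 i2 innovation_measurable by (intro integrable_mult_of_squares) auto
  have "(deviation (Suc n) \<omega>)\<^sup>2 = (1 + a / real n)\<^sup>2 * (deviation n \<omega>)\<^sup>2 + (innovation (Suc n) \<omega>)\<^sup>2
      + 2 * (1 + a / real n) * (deviation n \<omega> * innovation (Suc n) \<omega>)" for \<omega>
    by (simp only: deviation_Suc[OF assms] power2_sum power_mult_distrib mult.assoc)
  then have "expectation (\<lambda>\<omega>. (deviation (Suc n) \<omega>)\<^sup>2) = (1 + a / real n)\<^sup>2 * expectation (\<lambda>\<omega>. (deviation n \<omega>)\<^sup>2)
      + expectation (\<lambda>\<omega>. (innovation (Suc n) \<omega>)\<^sup>2)
      + 2 * (1 + a / real n) * expectation (\<lambda>\<omega>. deviation n \<omega> * innovation (Suc n) \<omega>)"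
    using d2 i2 di by simp
  then show ?thesis
    using innovation_orthogonal[OF assms(2) deviation_past[OF order_refl] d2] by simp
qed

lemma innovation_second_moment_deviation:
  assumes "a < 1" "1 \<le> n"
  shows "expectation (\<lambda>\<omega>. (innovation (Suc n) \<omega>)\<^sup>2) = m\<^sub>2 - centre\<^sup>2
      - (a / real n)\<^sup>2 * expectation (\<lambda>\<omega>. (deviation n \<omega>)\<^sup>2) - 2 * (a / real n) * centre * expectation (deviation n)"
proof -
  have "(a / real n * deviation n \<omega> + centre)\<^sup>2 = (a / real n)\<^sup>2 * (deviation n \<omega>)\<^sup>2
      + (2 * (a / real n) * centre * deviation n \<omega> + centre\<^sup>2)" for \<omega>
    by (simp only: power2_sum power_mult_distrib) (simp add: mult_ac)
  then have "expectation (\<lambda>\<omega>. (a / real n * deviation n \<omega> + centre)\<^sup>2) =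
      (a / real n)\<^sup>2 * expectation (\<lambda>\<omega>. (deviation n \<omega>)\<^sup>2) + (2 * (a / real n) * centre * expectation (deviation n) + centre\<^sup>2)"
    using deviation_square_integrable[of n] deviation_integrable[of n] by (simp add: prob_space del: times_divide_eq_left)
  then show ?thesis
    unfolding innovation_second_moment[OF assms(2)] predictor_eq[OF assms] by simp
qed

section \<open>The superdiffusive regime 1/2 < a < 1\<close>

context
  assumes superdiffusive: "1 / 2 < a" "a < 1"
begin

lemma a_pos: "0 < a" "0 < 2 * a"
  using superdiffusive by auto

text \<open>The terms behave like n^(-2 a), and 2 a > 1. The constant 4 is the square of 2, a bound
  for a ratio that tends to 1.\<close>

lemma summable_inverse_growth: "summable (\<lambda>n. 1 / (growth a n)\<^sup>2)"
proof (rule summable_comparison_test_ev)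
  show "summable (\<lambda>n. 4 * real n powr (- 2 * a))"
    using superdiffusive by (intro summable_mult) (simp add: summable_real_powr_iff)
  have "eventually (\<lambda>n. real n powr a / growth a n < 2) sequentially"
    using inverse_growth_asymptotic[OF a_pos(1)] by (rule order_tendstoD) simp
  then show "eventually (\<lambda>n. norm (1 / (growth a n)\<^sup>2) \<le> 4 * real n powr (- 2 * a)) sequentially"
    using eventually_ge_at_top[of 1]
  proof eventually_elim
    case (elim n)
    have g: "0 < growth a n" using growth_pos a_pos elim by auto
    have n: "0 < real n powr a" using elim by simp
    have "1 / growth a n \<le> 2 / real n powr a"
      using divide_right_mono[OF less_imp_le[OF elim(1)], of "real n powr a"] n by simp
    then have "(1 / growth a n)\<^sup>2 \<le> (2 / real n powr a)\<^sup>2"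
      using g by (intro power_mono) auto
    also have "\<dots> = 4 / real n powr (2 * a)"
      by (simp only: power_divide power2_eq_square mult_2 powr_add) simp
    also have "\<dots> = 4 * real n powr (- 2 * a)"
      by (simp add: powr_minus divide_inverse)
    finally show ?case by (simp add: power_divide)
  qed
qed

lemma deviation_mean: 
  assumes "1 \<le> n"
  shows "expectation (deviation n) = (m\<^sub>1 - centre) / Gamma (a + 1) * growth a n"
  using assms
proof (induction n rule: dec_induct)
  case base
  then show ?case
    using growth_1[of a] growth_pos[OF a_pos(1), of 1] deviation_first_moments(1) by simp
next
  case (step n)
  have "deviation (Suc n) = (\<lambda>\<omega>. (1 + a / real n) * deviation n \<omega> + innovation (Suc n) \<omega>)"
    by (rule ext) (rule deviation_Suc[OF superdiffusive(2) step(1)])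
  then have "expectation (deviation (Suc n)) = expectation (\<lambda>\<omega>. (1 + a / real n) * deviation n \<omega> + innovation (Suc n) \<omega>)"
    by (rule arg_cong)
  also have "\<dots> = (1 + a / real n) * expectation (deviation n)"
    using deviation_integrable[of n] innovation_mean[OF step(1)] by simp
  finally show ?case
    using step growth_Suc[OF a_pos(1) step(1)] by simp
qed

text \<open>The coefficient of \<open>growth (2 * a)\<close> in the solution of the second-moment
  recursion, fitted to the initial value at \<open>n = 1\<close>, where
  \<open>growth (2 * a) 1 = Gamma (2 * a + 1)\<close>.\<close>

definition limit_second_moment :: real where
  "limit_second_moment = (m\<^sub>2 - 2 * centre * m\<^sub>1 + centre\<^sup>2 + (m\<^sub>2 - centre\<^sup>2) / (2 * a - 1)
      - 2 * centre * (m\<^sub>1 - centre)) / Gamma (2 * a + 1)"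

text \<open>The last two terms form a particular solution of the recursion for the second moments.\<close>

lemma deviation_second_moment:
  assumes "1 \<le> n"
  shows "expectation (\<lambda>\<omega>. (deviation n \<omega>)\<^sup>2) = limit_second_moment * growth (2 * a) n
      - (m\<^sub>2 - centre\<^sup>2) / (2 * a - 1) * real n + 2 * centre * (m\<^sub>1 - centre) / Gamma (a + 1) * growth a n"
  using assms
proof (induction n rule: dec_induct)
  case base
  have "limit_second_moment * growth (2 * a) 1 = m\<^sub>2 - 2 * centre * m\<^sub>1 + centre\<^sup>2
      + (m\<^sub>2 - centre\<^sup>2) / (2 * a - 1) - 2 * centre * (m\<^sub>1 - centre)"
    using growth_1[of "2 * a"] growth_pos[OF a_pos(2), of 1] by (simp add: limit_second_moment_def)
  moreover have "2 * centre * (m\<^sub>1 - centre) / Gamma (a + 1) * growth a 1 = 2 * centre * (m\<^sub>1 - centre)"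
    using growth_1[of a] growth_pos[OF a_pos(1), of 1] by simp
  ultimately show ?case
    using deviation_first_moments(2) by simp
next
  case (step n)
  define e where "e = expectation (\<lambda>\<omega>. (deviation n \<omega>)\<^sup>2)"
  define s where "s = m\<^sub>2 - centre\<^sup>2"
  define C where "C = (m\<^sub>1 - centre) / Gamma (a + 1)"
  define g h where "g = growth (2 * a) n" and "h = growth a n"
  define x where "x = a / real n"
  have n: "x * real n = a" using step by (simp add: x_def)
  have e: "e = limit_second_moment * g - s / (2 * a - 1) * real n + 2 * centre * C * h"
    using step by (simp add: e_def s_def C_def g_def h_def)
  have "expectation (\<lambda>\<omega>. (deviation (Suc n) \<omega>)\<^sup>2) = (1 + x)\<^sup>2 * e + (s - x\<^sup>2 * e - 2 * x * centre * (C * h))"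
    unfolding deviation_second_moment_Suc[OF superdiffusive(2) step(1)]
      innovation_second_moment_deviation[OF superdiffusive(2) step(1)] deviation_mean[OF step(1)]
    by (simp add: e_def s_def C_def h_def x_def)
  \<comment> \<open>The terms \<open>x\<^sup>2 * e\<close> cancel: the square of 1 + x is reduced to
    1 + 2 x, which is the factor of \<open>growth (2 * a)\<close>.\<close>
  also have "\<dots> = (1 + 2 * x) * e + s - 2 * x * centre * (C * h)"
    by (simp add: power2_eq_square algebra_simps)
  \<comment> \<open>The linear term absorbs the constant \<open>s\<close>, since n + 2 a - (2 a - 1)
    = n + 1. The multiple of \<open>growth a\<close> absorbs the mean, since (1 + 2 x) h - x h = (1
    + x) h.\<close>
  also have "\<dots> = limit_second_moment * ((1 + 2 * x) * g) - s / (2 * a - 1) * (real n + 2 * (x * real n)) + s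
      + 2 * centre * C * ((1 + x) * h)"
    unfolding e by (simp add: algebra_simps)
  also have "\<dots> = limit_second_moment * ((1 + 2 * x) * g) - s / (2 * a - 1) * real (Suc n)
      + 2 * centre * C * ((1 + x) * h)"
    unfolding n using superdiffusive by (simp add: field_simps)
  also have "(1 + 2 * x) * g = growth (2 * a) (Suc n)"
    using growth_Suc[OF a_pos(2) step(1)] by (simp add: g_def x_def)
  also have "(1 + x) * h = growth a (Suc n)"
    using growth_Suc[OF a_pos(1) step(1)] by (simp add: h_def x_def)
  finally show ?case by (simp add: s_def C_def)
qed

text \<open>Both \<open>growth (2 * a) n\<close> and the square of \<open>growth a n\<close> are
  asymptotic to n^(2 a). Against this the linear term is of order n^(1 - 2 a), which vanishes
  because a > 1/2, and the last one of order n^(-a).\<close>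

lemma normalised_second_moment_tendsto:
  "(\<lambda>n. expectation (\<lambda>\<omega>. (deviation n \<omega> / growth a n)\<^sup>2)) \<longlonglongrightarrow> limit_second_moment"
proof -
  define s where "s = (m\<^sub>2 - centre\<^sup>2) / (2 * a - 1)"
  define C where "C = 2 * centre * (m\<^sub>1 - centre) / Gamma (a + 1)"
  let ?r = "\<lambda>n. real n powr a / growth a n"
  have "(\<lambda>n. limit_second_moment * (growth (2 * a) n / real n powr (2 * a)) * (?r n)\<^sup>2
      - s * real n powr (1 - 2 * a) * (?r n)\<^sup>2 + C * real n powr (- a) * ?r n)
      \<longlonglongrightarrow> limit_second_moment * 1 * 1\<^sup>2 - s * 0 * 1\<^sup>2 + C * 0 * 1"
  proof (intro tendsto_add tendsto_diff tendsto_mult tendsto_power tendsto_const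
      growth_asymptotic inverse_growth_asymptotic a_pos)
    show "(\<lambda>n. real n powr (1 - 2 * a)) \<longlonglongrightarrow> 0" "(\<lambda>n. real n powr (- a)) \<longlonglongrightarrow> 0"
      using superdiffusive by real_asymp+
  qed
  moreover have "eventually (\<lambda>n. limit_second_moment * (growth (2 * a) n / real n powr (2 * a)) * (?r n)\<^sup>2
      - s * real n powr (1 - 2 * a) * (?r n)\<^sup>2 + C * real n powr (- a) * ?r n
      = expectation (\<lambda>\<omega>. (deviation n \<omega> / growth a n)\<^sup>2)) sequentially"
    using eventually_ge_at_top[of 1]
  proof eventually_elim
    case (elim n)
    have g: "growth a n \<noteq> 0" using growth_pos[OF a_pos(1) elim] by simp
    have n: "real n powr a \<noteq> 0" using elim by simp
    have p: "real n powr (2 * a) = (real n powr a)\<^sup>2" "real n powr (1 - 2 * a) = real n / (real n powr a)\<^sup>2"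
      "real n powr (- a) = 1 / real n powr a"
      using elim by (simp_all add: powr_diff powr_minus powr_power field_simps)
    have "expectation (\<lambda>\<omega>. (deviation n \<omega> / growth a n)\<^sup>2) = expectation (\<lambda>\<omega>. (deviation n \<omega>)\<^sup>2) / (growth a n)\<^sup>2"
      by (simp add: power_divide)
    also have "\<dots> = (limit_second_moment * growth (2 * a) n - s * real n + C * growth a n) / (growth a n)\<^sup>2"
      unfolding deviation_second_moment[OF elim] s_def C_def by simp
    finally show ?case
      using g n unfolding p by (simp add: field_simps power2_eq_square)
  qed
  ultimately show ?thesis
    by (simp add: tendsto_cong)
qed

text \<open>Each innovation adds a nonnegative amount to the normalised second moment, so the limit
  dominates its value at time 2. The first summand contains the variance of \<open>\<xi> 1\<close>,
  the second measures the randomness of the second step.\<close>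

lemma limit_second_moment_ge:
  "limit_second_moment \<ge> (m\<^sub>2 - m\<^sub>1\<^sup>2 + (m\<^sub>1 - centre)\<^sup>2) / (Gamma (a + 1))\<^sup>2
      + expectation (\<lambda>\<omega>. (innovation (Suc 1) \<omega>)\<^sup>2) / (growth a (Suc 1))\<^sup>2"
proof -
  define v where "v n = expectation (\<lambda>\<omega>. (deviation (Suc n) \<omega> / growth a (Suc n))\<^sup>2)" for n
  have v_Suc: "v (Suc n) = v n + expectation (\<lambda>\<omega>. (innovation (Suc (Suc n)) \<omega>)\<^sup>2) / (growth a (Suc (Suc n)))\<^sup>2" for n
  proof -
    have g: "growth a (Suc (Suc n)) = (1 + a / real (Suc n)) * growth a (Suc n)"
      by (rule growth_Suc) (use a_pos in auto)
    have "0 < 1 + a / real (Suc n)" using a_pos by (simp add: add_pos_nonneg)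
    then have "(1 + a / real (Suc n))\<^sup>2 * x / (growth a (Suc (Suc n)))\<^sup>2 = x / (growth a (Suc n))\<^sup>2" for x
      unfolding g by (simp only: power_mult_distrib) simp
    then show ?thesis
      using deviation_second_moment_Suc[OF superdiffusive(2), of "Suc n"]
      by (simp add: v_def power_divide add_divide_distrib)
  qed
  have "v \<longlonglongrightarrow> limit_second_moment"
    unfolding v_def using normalised_second_moment_tendsto by (rule filterlim_compose) (rule filterlim_Suc)
  moreover have "incseq v"
    by (rule incseq_SucI) (simp add: v_Suc)
  ultimately have "v (Suc 0) \<le> limit_second_moment"
    by (intro incseq_le)
  moreover have "v 0 = (m\<^sub>2 - m\<^sub>1\<^sup>2 + (m\<^sub>1 - centre)\<^sup>2) / (Gamma (a + 1))\<^sup>2"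
    using deviation_first_moments(2) growth_1[of a]
    by (simp add: v_def power_divide power2_diff)
  ultimately show ?thesis using v_Suc[of 0] by simp
qed

lemma variance_nonneg: "m\<^sub>1\<^sup>2 \<le> m\<^sub>2"
proof -
  have "0 \<le> variance (\<xi> 1)" by (rule variance_positive)
  also have "\<dots> = m\<^sub>2 - m\<^sub>1\<^sup>2"
    using variance_eq[OF \<xi>_moments(3,1)[OF order_refl]] by (simp add: m\<^sub>1_def m\<^sub>2_def)
  finally show ?thesis by simp
qed

text \<open>The left side says that the variance of the limit is 0. For the converse implication,
  both alternatives give \<open>centre = m\<^sub>1\<close>, and then all terms cancel.\<close>

lemma degenerate_iff:
  "limit_second_moment = ((m\<^sub>1 - centre) / Gamma (a + 1))\<^sup>2 \<longleftrightarrow> m\<^sub>2 = m\<^sub>1\<^sup>2 \<and> (m\<^sub>1 = 0 \<or> p = 1)"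
proof
  assume eq: "limit_second_moment = ((m\<^sub>1 - centre) / Gamma (a + 1))\<^sup>2"
  define I where "I = expectation (\<lambda>\<omega>. (innovation (Suc 1) \<omega>)\<^sup>2)"
  have \<Gamma>: "0 < (Gamma (a + 1))\<^sup>2" and g: "0 < (growth a (Suc 1))\<^sup>2"
    using growth_pos[OF a_pos(1), of 1] growth_pos[OF a_pos(1), of "Suc 1"] growth_1[of a] by auto
  have "0 \<le> I" by (simp add: I_def)
  have "(m\<^sub>2 - m\<^sub>1\<^sup>2) / (Gamma (a + 1))\<^sup>2 + I / (growth a (Suc 1))\<^sup>2 \<le> 0"
    using limit_second_moment_ge unfolding eq I_def by (simp add: add_divide_distrib power_divide)
  moreover have "0 \<le> (m\<^sub>2 - m\<^sub>1\<^sup>2) / (Gamma (a + 1))\<^sup>2" "0 \<le> I / (growth a (Suc 1))\<^sup>2"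
    using variance_nonneg \<open>0 \<le> I\<close> by auto
  ultimately have "(m\<^sub>2 - m\<^sub>1\<^sup>2) / (Gamma (a + 1))\<^sup>2 = 0" "I / (growth a (Suc 1))\<^sup>2 = 0"
    by linarith+
  then have m: "m\<^sub>2 = m\<^sub>1\<^sup>2" and I: "I = 0" using \<Gamma> g by auto
  have c: "centre * (1 - a) = (1 - \<alpha>) * m\<^sub>1"
    using superdiffusive by (simp add: centre_def)
  \<comment> \<open>With zero variance the first step is the constant \<open>m\<^sub>1\<close>, so
    the predictor of the second step is \<open>(1 - \<alpha> + a) * m\<^sub>1\<close>, and
    \<open>I\<close> compares the square of this number with
    \<open>m\<^sub>1\<^sup>2\<close>.\<close>
  have "I = m\<^sub>1\<^sup>2 - (centre + a * (m\<^sub>1 - centre))\<^sup>2"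
    using innovation_second_moment_deviation[OF superdiffusive(2) order_refl, unfolded deviation_first_moments m, folded I_def]
    by (simp add: power2_eq_square algebra_simps)
  also have "centre + a * (m\<^sub>1 - centre) = (1 - \<alpha> + a) * m\<^sub>1"
    using c by (simp add: algebra_simps)
  finally have "m\<^sub>1\<^sup>2 - ((1 - \<alpha> + a) * m\<^sub>1)\<^sup>2 = 0"
    using I by linarith
  moreover have "m\<^sub>1\<^sup>2 * (1 - x\<^sup>2) = m\<^sub>1\<^sup>2 - (x * m\<^sub>1)\<^sup>2" for x
    by (simp add: power2_eq_square algebra_simps)
  ultimately have "m\<^sub>1\<^sup>2 * (1 - (1 - \<alpha> + a)\<^sup>2) = 0"
    by (simp only:)
  then have "m\<^sub>1\<^sup>2 = 0 \<or> 1 - (1 - \<alpha> + a)\<^sup>2 = 0"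
    by (rule mult_eq_0_iff[THEN iffD1])
  then have "m\<^sub>1 = 0 \<or> (1 - \<alpha> + a)\<^sup>2 = 1"
    by (elim disj_forward) (simp, linarith)
  moreover have "p = 1" if "(1 - \<alpha> + a)\<^sup>2 = 1"
  proof -
    have "1 - \<alpha> + a = 1 \<or> 1 - \<alpha> + a = - 1" using that by (simp add: power2_eq_1_iff)
    \<comment> \<open>The value -1 is excluded since 1 - \<alpha> + a \<ge> a > 1/2.\<close>
    then have "a = \<alpha>" using superdiffusive \<alpha>_range by auto
    then have "(2 * p - 1) * \<alpha> = 1 * \<alpha>" by (simp add: a_def)
    then show ?thesis using \<alpha>_range by simp
  qed
  ultimately show "m\<^sub>2 = m\<^sub>1\<^sup>2 \<and> (m\<^sub>1 = 0 \<or> p = 1)" using m by blast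
next
  assume *: "m\<^sub>2 = m\<^sub>1\<^sup>2 \<and> (m\<^sub>1 = 0 \<or> p = 1)"
  have "centre = m\<^sub>1"
  proof (cases "p = 1")
    case True
    then have "(2 * p - 1) * \<alpha> = \<alpha>" by simp
    then have "a = \<alpha>" by (simp only: a_def)
    then show ?thesis using superdiffusive by (simp add: centre_def)
  qed (use * in \<open>simp add: centre_def\<close>)
  then show "limit_second_moment = ((m\<^sub>1 - centre) / Gamma (a + 1))\<^sup>2"
    using * by (simp add: limit_second_moment_def power2_eq_square)
qed

lemma superdiffusive_limit:
  obtains L where "L \<in> borel_measurable M" "integrable M (\<lambda>\<omega>. (L \<omega>)\<^sup>2)"
    "AE \<omega> in M. (\<lambda>n. real n powr (1 - a) * (position n \<omega> / real n - (1 - \<alpha>) * m\<^sub>1 / (1 - a))) \<longlonglongrightarrow> L \<omega>"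
    "expectation L = (m\<^sub>1 - centre) / Gamma (a + 1)"
    "expectation (\<lambda>\<omega>. (L \<omega>)\<^sup>2) = limit_second_moment"
    "(\<exists>c. AE \<omega> in M. L \<omega> = c) \<longleftrightarrow> m\<^sub>2 = m\<^sub>1\<^sup>2 \<and> (m\<^sub>1 = 0 \<or> p = 1)"
proof -
  interpret D: martingale_differences M "\<lambda>n. past (Suc n)"
     "\<lambda>n \<omega>. (if n = 0 then deviation 1 \<omega> else innovation (Suc n) \<omega>) / growth a (Suc n)"
    by (rule martingale_innovations)
  note sum = summable_innovation_moments[OF summable_inverse_growth]
  have S: "D.S n \<omega> = deviation (Suc n) \<omega> / growth a (Suc n)" for n \<omega>
  proof (induction n)
    case (Suc n)
    have "growth a (Suc (Suc n)) = (1 + a / real (Suc n)) * growth a (Suc n)"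
      by (rule growth_Suc) (use a_pos in auto)
    moreover have "0 < growth a (Suc (Suc n))" by (rule growth_pos) (use a_pos in auto)
    ultimately have "deviation (Suc n) \<omega> / growth a (Suc n) =
        (1 + a / real (Suc n)) * deviation (Suc n) \<omega> / growth a (Suc (Suc n))"
      by auto
    then show ?case
      using Suc deviation_Suc[OF superdiffusive(2), of "Suc n" \<omega>] by (simp add: D.S_Suc add_divide_distrib)
  qed (simp add: D.S_def)
  \<comment> \<open>\<open>lim\<close> has some value on divergent paths too, so \<open>L\<close> is
    defined and measurable everywhere and is the limit off a null set.\<close>
  define L where "L \<omega> = lim (\<lambda>n. D.S n \<omega>)" for \<omega>
  have L [measurable]: "L \<in> borel_measurable M"
    unfolding L_def[abs_def] by measurable
  have lim: "AE \<omega> in M. (\<lambda>n. D.S n \<omega>) \<longlonglongrightarrow> L \<omega>"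
    using D.AE_convergent[OF sum] by eventually_elim (simp add: L_def convergent_LIMSEQ_iff)
  have cauchy: "expectation (\<lambda>\<omega>. (D.S n \<omega> - D.S m \<omega>)\<^sup>2) \<le> D.tail m" if "m \<le> n" for m n
    unfolding D.increment_second_moment[OF that] by (rule D.partial_tail_le[OF sum])
  note L2 = L2_limit[OF D.S_measurable L D.S_square_integrable cauchy D.tail_tendsto[OF sum] lim]
  have mean: "expectation (D.S n) = (m\<^sub>1 - centre) / Gamma (a + 1)" for n
  proof -
    have "expectation (D.S n) = expectation (deviation (Suc n)) / growth a (Suc n)"
      unfolding S[abs_def] by simp
    then show ?thesis
      using deviation_mean[of "Suc n"] growth_pos[OF a_pos(1), of "Suc n"] by simp
  qed
  have EL: "expectation L = (m\<^sub>1 - centre) / Gamma (a + 1)"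
    using L2(2) unfolding mean by (simp add: LIMSEQ_const_iff)
  have "(\<lambda>n. expectation (\<lambda>\<omega>. (D.S n \<omega>)\<^sup>2)) \<longlonglongrightarrow> limit_second_moment"
    unfolding S using normalised_second_moment_tendsto by (rule filterlim_compose) (rule filterlim_Suc)
  with L2(3) have EL2: "expectation (\<lambda>\<omega>. (L \<omega>)\<^sup>2) = limit_second_moment"
    by (rule LIMSEQ_unique)
  have conv: "AE \<omega> in M. (\<lambda>n. real n powr (1 - a) * (position n \<omega> / real n - (1 - \<alpha>) * m\<^sub>1 / (1 - a))) \<longlonglongrightarrow> L \<omega>"
    using lim
  proof eventually_elim
    case (elim \<omega>)
    then have "(\<lambda>n. deviation n \<omega> / growth a n) \<longlonglongrightarrow> L \<omega>"
      unfolding S by (rule LIMSEQ_imp_Suc)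
    from tendsto_mult[OF growth_asymptotic[OF a_pos(1)] this]
    have "(\<lambda>n. growth a n / real n powr a * (deviation n \<omega> / growth a n)) \<longlonglongrightarrow> L \<omega>" by simp
    moreover have "eventually (\<lambda>n. growth a n / real n powr a * (deviation n \<omega> / growth a n) =
        real n powr (1 - a) * (position n \<omega> / real n - (1 - \<alpha>) * m\<^sub>1 / (1 - a))) sequentially"
      using eventually_ge_at_top[of 1]
    proof eventually_elim
      case (elim n)
      have "growth a n \<noteq> 0" using growth_pos[OF a_pos(1) elim] by simp
      moreover have "real n powr (1 - a) = real n / real n powr a"
        using elim by (simp add: powr_diff)
      ultimately show ?case
        using elim unfolding deviation_div[OF elim, symmetric] by simp
    qed
    ultimately show ?case by (rule Lim_transform_eventually)
  qed
  have Li: "integrable M L"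
    by (rule square_integrable_imp_integrable[OF L L2(1)])
  \<comment> \<open>Almost sure constancy is vanishing variance, that is, equality of the second
    moment and the squared mean.\<close>
  have "(\<exists>c. AE \<omega> in M. L \<omega> = c) \<longleftrightarrow> limit_second_moment = ((m\<^sub>1 - centre) / Gamma (a + 1))\<^sup>2"
  proof
    assume "\<exists>c. AE \<omega> in M. L \<omega> = c"
    then obtain c where c: "AE \<omega> in M. L \<omega> = c" by blast
    have "expectation L = expectation (\<lambda>_. c)"
      by (rule integral_cong_AE) (use c in auto)
    moreover have "expectation (\<lambda>\<omega>. (L \<omega>)\<^sup>2) = expectation (\<lambda>_. c\<^sup>2)"
      by (rule integral_cong_AE) (use c in auto)
    ultimately show "limit_second_moment = ((m\<^sub>1 - centre) / Gamma (a + 1))\<^sup>2"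
      using EL EL2 by (simp add: prob_space)
  next
    assume "limit_second_moment = ((m\<^sub>1 - centre) / Gamma (a + 1))\<^sup>2"
    then have "expectation (\<lambda>\<omega>. (L \<omega> - expectation L)\<^sup>2) = 0"
      using variance_eq[OF Li L2(1)] EL EL2 by simp
    moreover have "integrable M (\<lambda>\<omega>. (L \<omega> - expectation L)\<^sup>2)"
      using integrable_square_add[OF L _ L2(1), of "\<lambda>_. - expectation L"] by simp
    ultimately have "AE \<omega> in M. (L \<omega> - expectation L)\<^sup>2 = 0"
      by (subst (asm) integral_nonneg_eq_0_iff_AE) auto
    then show "\<exists>c. AE \<omega> in M. L \<omega> = c"
      by (intro exI[of _ "expectation L"]) simp
  qed
  then show thesis
    using that[OF L L2(1) conv EL EL2] degenerate_iff by simp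
qed

end

end

section \<open>The three regimes for the original walk\<close>

theorem theorem3:
  fixes M :: "'a measure"
    and p \<alpha> a \<mu>\<^sub>1 \<mu>\<^sub>2 \<sigma>2 :: real
    and \<xi> \<gamma> \<rho> X T :: "nat \<Rightarrow> 'a \<Rightarrow> real"
    and U :: "nat \<Rightarrow> 'a \<Rightarrow> nat"
  assumes walk: "step_reinforced_walk M p \<alpha> \<xi> U \<gamma> \<rho> X"
    and T: "T = (\<lambda>n \<omega>. \<Sum>k=1..n. X k \<omega>)"
    and a: "a = (2 * p - 1) * \<alpha>"
    and moment: "integrable M (\<lambda>\<omega>. (\<xi> 1 \<omega>)\<^sup>2)"
    and \<mu>\<^sub>1: "\<mu>\<^sub>1 = (\<integral>\<omega>. \<xi> 1 \<omega> \<partial>M)"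
    and \<mu>\<^sub>2: "\<mu>\<^sub>2 = (\<integral>\<omega>. (\<xi> 1 \<omega>)\<^sup>2 \<partial>M)"
    and \<sigma>2: "a < 1 \<Longrightarrow> \<sigma>2 = \<mu>\<^sub>2 - (1 - \<alpha>)\<^sup>2 * \<mu>\<^sub>1\<^sup>2 / (1 - a)\<^sup>2"
  shows
    "(- 1 \<le> a \<and> a < 1 / 2 \<longrightarrow>
       (\<forall>\<delta>::real > 0. AE \<omega> in M.
         (\<lambda>n. sqrt (real n) / (ln (real n) powr (1 / 2 + \<delta>)) *
              (T n \<omega> / real n - (1 - \<alpha>) * \<mu>\<^sub>1 / (1 - a))) \<longlonglongrightarrow> 0))
   \<and> (a = 1 / 2 \<longrightarrow>
       (\<forall>\<delta>::real > 0. AE \<omega> in M.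
         (\<lambda>n. sqrt (real n) / (sqrt (ln (real n)) * ln (ln (real n)) powr (1 / 2 + \<delta>)) *
              (T n \<omega> / real n - 2 * (1 - \<alpha>) * \<mu>\<^sub>1)) \<longlonglongrightarrow> 0))
   \<and> (1 / 2 < a \<and> a < 1 \<longrightarrow>
       (\<exists>L :: 'a \<Rightarrow> real.
          L \<in> borel_measurable M \<and> integrable M (\<lambda>\<omega>. (L \<omega>)\<^sup>2)
        \<and> (AE \<omega> in M.
            (\<lambda>n. real n powr (1 - a) *
                 (T n \<omega> / real n - (1 - \<alpha>) * \<mu>\<^sub>1 / (1 - a))) \<longlonglongrightarrow> L \<omega>)
        \<and> (\<integral>\<omega>. L \<omega> \<partial>M) = (\<alpha> - a) * \<mu>\<^sub>1 / ((1 - a) * Gamma (a + 1))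
        \<and> (\<integral>\<omega>. (L \<omega>)\<^sup>2 \<partial>M) =
              \<mu>\<^sub>2 / Gamma (2 * a + 1)
            - (1 - \<alpha>) * (1 + \<alpha> - 2 * a) * \<mu>\<^sub>1\<^sup>2 / ((1 - a)\<^sup>2 * Gamma (2 * a + 1))
            + \<sigma>2 / ((2 * a - 1) * Gamma (2 * a + 1))
            - 2 * (1 - \<alpha>) * (\<alpha> - a) * \<mu>\<^sub>1\<^sup>2 / ((1 - a)\<^sup>2 * Gamma (2 * a + 1))
        \<and> ((\<exists>c. AE \<omega> in M. L \<omega> = c) \<longleftrightarrow>
              \<mu>\<^sub>2 = \<mu>\<^sub>1\<^sup>2 \<and> (\<mu>\<^sub>1 = 0 \<or> p = 1))))"
proof -
  interpret W: square_integrable_walk M p \<alpha> \<xi> U \<gamma> \<rho> X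
    using walk moment by (simp add: square_integrable_walk_def square_integrable_walk_axioms_def)
  have a': "W.a = a" and m1: "W.m\<^sub>1 = \<mu>\<^sub>1" and m2: "W.m\<^sub>2 = \<mu>\<^sub>2"
    by (simp_all add: W.a_def a W.m\<^sub>1_def \<mu>\<^sub>1 W.m\<^sub>2_def \<mu>\<^sub>2)
  \<comment> \<open>A single null set serves all \<open>n\<close>, so that limits along paths carry
    over from the pointwise version of the walk to \<open>T\<close>.\<close>
  have position: "AE \<omega> in M. \<forall>n. W.position n \<omega> = T n \<omega>"
    using W.AE_X_eq_step by eventually_elim (auto simp: W.position_def T intro!: sum.cong)
  have to_T: "AE \<omega> in M. (\<lambda>n. f n (T n \<omega>)) \<longlonglongrightarrow> l \<omega>"
    if "AE \<omega> in M. (\<lambda>n. f n (W.position n \<omega>)) \<longlonglongrightarrow> l \<omega>" for f :: "nat \<Rightarrow> real \<Rightarrow> real" and l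
    using that position by eventually_elim simp
  show ?thesis
  proof (intro conjI impI allI)
    fix \<delta> :: real
    assume "- 1 \<le> a \<and> a < 1 / 2" "0 < \<delta>"
    then show "AE \<omega> in M. (\<lambda>n. sqrt (real n) / (ln (real n) powr (1 / 2 + \<delta>)) *
        (T n \<omega> / real n - (1 - \<alpha>) * \<mu>\<^sub>1 / (1 - a))) \<longlonglongrightarrow> 0"
      using W.diffusive_limit[of \<delta>] unfolding a' m1 by (intro to_T) auto
  next
    fix \<delta> :: real
    assume half: "a = 1 / 2" and "0 < \<delta>"
    have eq: "(1 - \<alpha>) * \<mu>\<^sub>1 / (1 - a) = 2 * (1 - \<alpha>) * \<mu>\<^sub>1"
      unfolding half by simp
    from W.critical_limit[of \<delta>, unfolded a' m1 eq, OF half \<open>0 < \<delta>\<close>] show "AE \<omega> in M. (\<lambda>n. sqrt (real n) / (sqrt (ln (real n)) * ln (ln (real n)) powr (1 / 2 + \<delta>)) *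
        (T n \<omega> / real n - 2 * (1 - \<alpha>) * \<mu>\<^sub>1)) \<longlonglongrightarrow> 0"
      by (rule to_T)
  next
    assume a1: "1 / 2 < a \<and> a < 1"
    then have sup: "1 / 2 < W.a" "W.a < 1" by (simp_all add: a')
    obtain L where L: "L \<in> borel_measurable M" "integrable M (\<lambda>\<omega>. (L \<omega>)\<^sup>2)"
      "AE \<omega> in M. (\<lambda>n. real n powr (1 - a) * (W.position n \<omega> / real n - (1 - \<alpha>) * \<mu>\<^sub>1 / (1 - a))) \<longlonglongrightarrow> L \<omega>"
      "W.expectation L = (\<mu>\<^sub>1 - W.centre) / Gamma (a + 1)"
      "W.expectation (\<lambda>\<omega>. (L \<omega>)\<^sup>2) = W.limit_second_moment"
      "(\<exists>c. AE \<omega> in M. L \<omega> = c) \<longleftrightarrow> \<mu>\<^sub>2 = \<mu>\<^sub>1\<^sup>2 \<and> (\<mu>\<^sub>1 = 0 \<or> p = 1)"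
      using W.superdiffusive_limit[OF sup] unfolding a' m1 m2 by blast
    define G where "G = Gamma (2 * a + 1)"
    have centre: "W.centre = (1 - \<alpha>) * \<mu>\<^sub>1 / (1 - a)" by (simp add: W.centre_def a' m1)
    have diff: "\<mu>\<^sub>1 - W.centre = (\<alpha> - a) * \<mu>\<^sub>1 / (1 - a)"
      unfolding centre using a1 by (simp add: field_simps)
    have s: "\<mu>\<^sub>2 - W.centre\<^sup>2 = \<sigma>2"
      using \<sigma>2 a1 by (simp add: centre power_divide power_mult_distrib)
    \<comment> \<open>Both terms share the factor 1 - \<alpha>, and (1 - \<alpha>) - 2 (1 - a) = -(1
      + \<alpha> - 2 a).\<close>
    have A: "W.centre\<^sup>2 - 2 * W.centre * \<mu>\<^sub>1 = - ((1 - \<alpha>) * (1 + \<alpha> - 2 * a) * \<mu>\<^sub>1\<^sup>2 / (1 - a)\<^sup>2)"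
    proof -
      define d where "d = 1 - a"
      have d: "a = 1 - d" "d \<noteq> 0" using a1 by (auto simp: d_def)
      show ?thesis
        unfolding centre unfolding d(1) using d(2) by (simp add: field_simps power2_eq_square)
    qed
    have B: "2 * W.centre * (\<mu>\<^sub>1 - W.centre) = 2 * (1 - \<alpha>) * (\<alpha> - a) * \<mu>\<^sub>1\<^sup>2 / (1 - a)\<^sup>2"
      unfolding diff unfolding centre by (simp add: power2_eq_square mult_ac)
    have "W.limit_second_moment = (\<mu>\<^sub>2 + (W.centre\<^sup>2 - 2 * W.centre * \<mu>\<^sub>1) + (\<mu>\<^sub>2 - W.centre\<^sup>2) / (2 * a - 1)
        - 2 * W.centre * (\<mu>\<^sub>1 - W.centre)) / G"
      unfolding W.limit_second_moment_def[OF sup] a' m1 m2 G_def by simp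
    also have "\<dots> = \<mu>\<^sub>2 / G - (1 - \<alpha>) * (1 + \<alpha> - 2 * a) * \<mu>\<^sub>1\<^sup>2 / ((1 - a)\<^sup>2 * G)
            + \<sigma>2 / ((2 * a - 1) * G) - 2 * (1 - \<alpha>) * (\<alpha> - a) * \<mu>\<^sub>1\<^sup>2 / ((1 - a)\<^sup>2 * G)"
      unfolding A B s by (simp add: add_divide_distrib diff_divide_distrib)
    finally show "\<exists>L :: 'a \<Rightarrow> real.
          L \<in> borel_measurable M \<and> integrable M (\<lambda>\<omega>. (L \<omega>)\<^sup>2)
        \<and> (AE \<omega> in M.
            (\<lambda>n. real n powr (1 - a) *
                 (T n \<omega> / real n - (1 - \<alpha>) * \<mu>\<^sub>1 / (1 - a))) \<longlonglongrightarrow> L \<omega>)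
        \<and> (\<integral>\<omega>. L \<omega> \<partial>M) = (\<alpha> - a) * \<mu>\<^sub>1 / ((1 - a) * Gamma (a + 1))
        \<and> (\<integral>\<omega>. (L \<omega>)\<^sup>2 \<partial>M) =
              \<mu>\<^sub>2 / Gamma (2 * a + 1)
            - (1 - \<alpha>) * (1 + \<alpha> - 2 * a) * \<mu>\<^sub>1\<^sup>2 / ((1 - a)\<^sup>2 * Gamma (2 * a + 1))
            + \<sigma>2 / ((2 * a - 1) * Gamma (2 * a + 1))
            - 2 * (1 - \<alpha>) * (\<alpha> - a) * \<mu>\<^sub>1\<^sup>2 / ((1 - a)\<^sup>2 * Gamma (2 * a + 1))
        \<and> ((\<exists>c. AE \<omega> in M. L \<omega> = c) \<longleftrightarrow>
              \<mu>\<^sub>2 = \<mu>\<^sub>1\<^sup>2 \<and> (\<mu>\<^sub>1 = 0 \<or> p = 1))"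
      using L to_T[OF L(3)] by (intro exI[of _ L]) (simp add: diff G_def)
  qed
qed

end
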